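(* Let $(X,\sigma)$ be a subshift over a finite alphabet and suppose there exists $k\in\mathbb{N}$ such that $$\limsup_{n\to\infty}\frac{P_X(n)}{n}<k.$$ If $(X,\sigma)$ has a generic measure $\mu$ and a generic point $x_\mu$ for $\mu$ such that the orbit closure $$\overline{\{\sigma^{j}x_\mu\colon j\in\mathbb{Z}\}}$$ is not uniquely ergodic, then $(X,\sigma)$ has at most $k-2$ distinct, nonatomic, generic measures.
   Context: A subshift $(X,\sigma)$ is a closed subset $X\subset\mathcal{A}^{\mathbb{Z}}$, where $\mathcal{A}$ is a finite alphabet with the discrete topology and $\mathcal{A}^{\mathbb{Z}}$ has the product topology, that is invariant under the left shift $\sigma\colon\mathcal{A}^{\mathbb{Z}}\to\mathcal{A}^{\mathbb{Z}}$, $(\sigma x)(n)=x(n+1)$. The complexity function $P_X(n)$ is the number of distinct words of length $n$ that occur as (contiguous) subwords of elements of $X$. Let $\mu$ be a $\sigma$-invariant Borel probability measure on $X$. A point $x\in X$ is generic for $\mu$ if for every continuous $f\colon X\to\mathbb{R}$, $$\lim_{N\to\infty}\frac1N\sum_{n=0}^{N-1}f(\sigma^n x)=\int f\,d\mu.$$ The measure $\mu$ is called generic if it has a generic point in $X$. A generic measure need not be ergodic. A measure is nonatomic if every point has measure zero. A closed $\sigma$-invariant set is uniquely ergodic if it supports exactly one $\sigma$-invariant Borel probability measure. *)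

theory Defs
  imports "HOL-Probability.Probability_Measure"
begin

text \<open>
  The alphabet is a finite set \<open>A\<close> of letters drawn from a type of class \<^class>\<open>discrete_topology\<close>,
  so that the library's topology on \<^typ>\<open>int \<Rightarrow> 'a\<close> is the product of discrete topologies and its
  restriction to \<open>UNIV \<rightarrow> A\<close> is the full shift over \<open>A\<close>.
\<close>

definition shift :: "(int \<Rightarrow> 'a) \<Rightarrow> (int \<Rightarrow> 'a)" where
  "shift x = (\<lambda>n. x (n + 1))"

text \<open>Since \<^const>\<open>shift\<close> is invertible, invariance of a set means \<open>shift ` X = X\<close>.\<close>

definition subshift :: "'a::discrete_topology set \<Rightarrow> (int \<Rightarrow> 'a) set \<Rightarrow> bool" where
  "subshift A X \<longleftrightarrow> closedin (top_of_set (UNIV \<rightarrow> A)) X \<and> shift ` X = X"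

definition words :: "(int \<Rightarrow> 'a) set \<Rightarrow> nat \<Rightarrow> 'a list set" where
  "words X n = {map (\<lambda>j. x (i + int j)) [0..<n] | x i. x \<in> X}"

definition complexity :: "(int \<Rightarrow> 'a) set \<Rightarrow> nat \<Rightarrow> nat" where
  "complexity X n = card (words X n)"

definition invariant_measure ::
    "(int \<Rightarrow> 'a::discrete_topology) set \<Rightarrow> (int \<Rightarrow> 'a) measure \<Rightarrow> bool" where
  "invariant_measure X \<mu> \<longleftrightarrow>
     prob_space \<mu> \<and> sets \<mu> = sets (restrict_space borel X) \<and>
     shift \<in> measurable \<mu> \<mu> \<and> distr \<mu> \<mu> shift = \<mu>"

definition generic_point ::
    "(int \<Rightarrow> 'a::discrete_topology) set \<Rightarrow> (int \<Rightarrow> 'a) measure \<Rightarrow> (int \<Rightarrow> 'a) \<Rightarrow> bool" where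
  "generic_point X \<mu> x \<longleftrightarrow> x \<in> X \<and>
     (\<forall>f :: (int \<Rightarrow> 'a) \<Rightarrow> real. continuous_on X f \<longrightarrow>
        (\<lambda>N. (1 / real N) * (\<Sum>n<N. f ((shift ^^ n) x))) \<longlonglongrightarrow> (\<integral>y. f y \<partial>\<mu>))"

definition generic_measure ::
    "(int \<Rightarrow> 'a::discrete_topology) set \<Rightarrow> (int \<Rightarrow> 'a) measure \<Rightarrow> bool" where
  "generic_measure X \<mu> \<longleftrightarrow> invariant_measure X \<mu> \<and> (\<exists>x. generic_point X \<mu> x)"

definition nonatomic :: "'b measure \<Rightarrow> bool" where
  "nonatomic \<mu> \<longleftrightarrow> (\<forall>x \<in> space \<mu>. emeasure \<mu> {x} = 0)"

text \<open>The point \<open>\<lambda>n. x (n + j)\<close> is the image of \<open>x\<close> under the \<open>j\<close>-th power of the shift, for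
  any integer \<open>j\<close>, so this is the two-sided orbit.\<close>

definition shift_orbit :: "(int \<Rightarrow> 'a) \<Rightarrow> (int \<Rightarrow> 'a) set" where
  "shift_orbit x = {\<lambda>n. x (n + j) | j :: int. True}"

definition uniquely_ergodic :: "(int \<Rightarrow> 'a::discrete_topology) set \<Rightarrow> bool" where
  "uniquely_ergodic Y \<longleftrightarrow> (\<exists>!\<nu>. invariant_measure Y \<nu>)"

end

theory Submission imports Defs
begin

text \<open>
  Suppose there were \<open>k - 1\<close> distinct nonatomic generic measures. Since \<open>P(n) \<le> q n\<close> for some
  \<open>q < k\<close>, every interval \<open>[\<delta>S, S]\<close> with \<open>S\<close> large contains a length \<open>n\<close> with
  \<open>P(n + 1) - P(n) \<le> k - 1\<close>. A generic point of a nonatomic measure \<open>\<nu>\<close> is not eventually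
  periodic, so it meets a right special word of length \<open>n\<close> within its first \<open>P(n)\<close> steps, and by
  genericity this word looks like \<open>\<nu>\<close>: short words have nearly the same frequencies in it as
  under \<open>\<nu>\<close>. Hence there is exactly one right special word \<open>v\<^sub>\<nu>\<close> for each of the measures, it
  has exactly two continuations, and there are no other right special words.

  If \<open>\<mu>\<close> is one of the measures, \<open>n\<close> can be chosen such that \<open>x\<close> uses both continuations
  of \<open>v\<^sub>\<mu>\<close> in a window of length \<open>O(n)\<close>; then everything that follows \<open>v\<^sub>\<mu>\<close> in the Rauzy graph
  looks like \<open>\<mu>\<close>. Should \<open>x\<close> pass through some other \<open>v\<^sub>\<nu>\<close>, the continuation taken at the last
  such passage leads only to words looking like \<open>\<mu>\<close> or to no right special word at all, so a
  generic point of \<open>\<nu>\<close> must always choose the other continuation and is eventually periodic, which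
  is absurd. So \<open>x\<close>, which meets right special words arbitrarily far to the left, meets only
  \<open>v\<^sub>\<mu>\<close>, and all its long words look like \<open>\<mu>\<close>, which makes its orbit closure uniquely ergodic.
\<close>

section \<open>Right special words\<close>

definition window :: "(int \<Rightarrow> 'a) \<Rightarrow> int \<Rightarrow> nat \<Rightarrow> 'a list" where
  "window y t n = map (\<lambda>j. y (t + int j)) [0..<n]"

definition right_special :: "(int \<Rightarrow> 'a) set \<Rightarrow> nat \<Rightarrow> 'a list \<Rightarrow> bool" where
  "right_special X n w \<longleftrightarrow>
     (\<exists>a b. a \<noteq> b \<and> w @ [a] \<in> words X (Suc n) \<and> w @ [b] \<in> words X (Suc n))"

definition eventually_periodic :: "(int \<Rightarrow> 'a) \<Rightarrow> bool" where
  "eventually_periodic y \<longleftrightarrow> (\<exists>p>0. \<exists>T. \<forall>t\<ge>T. y (t + p) = y t)"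

lemma length_window [simp]: "length (window y t n) = n"
  by (simp add: window_def)

lemma nth_window [simp]: "i < n \<Longrightarrow> window y t n ! i = y (t + int i)"
  by (simp add: window_def)

lemma words_eq_windows: "words X n = {window y i n | y i. y \<in> X}"
  by (simp add: words_def window_def)

lemma window_in_words: "y \<in> X \<Longrightarrow> window y t n \<in> words X n"
  by (auto simp: words_eq_windows)

lemma window_Suc: "window y t (Suc n) = window y t n @ [y (t + int n)]"
  by (simp add: window_def)

lemma window_Suc_Cons: "window y t (Suc n) = y t # window y (t + 1) n"
  by (rule nth_equalityI) (auto simp: nth_Cons algebra_simps split: nat.split)

lemma window_extend: "y \<in> X \<Longrightarrow> window y t n @ [y (t + int n)] \<in> words X (Suc n)"
  by (metis window_Suc window_in_words)

lemma tl_window_extend: "tl (window y t n @ [y (t + int n)]) = window y (t + 1) n"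
  by (metis window_Suc window_Suc_Cons list.sel(3))

lemma window_step:
  assumes "window y s n = window y' t n" "y (s + int n) = y' (t + int n)"
  shows "window y (s + 1) n = window y' (t + 1) n"
  by (metis assms tl_window_extend)

section \<open>Repeated words and periodicity\<close>

lemma not_right_special_unique:
  assumes "\<not> right_special X n w" "w @ [a] \<in> words X (Suc n)" "w @ [b] \<in> words X (Suc n)"
  shows "a = b"
  using assms by (auto simp: right_special_def)

text \<open>Once a word recurs and every word read between the two occurrences fixes its successor,
  the reading runs round a closed path for ever. Determinism is asked of \<open>y\<close> alone and
  not of \<open>X\<close>, so that a right special word is allowed as long as \<open>y\<close>
  always leaves it by the same letter.\<close>

lemma repeat_forces_periodicity:
  assumes ab: "a < b" "window y a n = window y b n"
    and det: "\<And>s t. a \<le> s \<Longrightarrow> s < b \<Longrightarrow> a \<le> t \<Longrightarrow> window y t n = window y s n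
                \<Longrightarrow> y (t + int n) = y (s + int n)"
    and t: "a \<le> t"
  shows "window y (t + (b - a)) n = window y t n"
    and "\<exists>s. a \<le> s \<and> s < b \<and> window y t n = window y s n"
proof -
  have *: "window y (b + int j) n = window y (a + int j) n \<and>
        (\<exists>s. a \<le> s \<and> s < b \<and> window y (a + int j) n = window y s n)" for j
  proof (induction j rule: less_induct)
    case (less j)
    have 1: "window y (b + int j) n = window y (a + int j) n"
    proof (cases j)
      case 0
      then show ?thesis using ab by simp
    next
      case (Suc i)
      then have IH: "window y (b + int i) n = window y (a + int i) n"
        and "\<exists>s. a \<le> s \<and> s < b \<and> window y (a + int i) n = window y s n"
        using less by auto
      then obtain s where s: "a \<le> s" "s < b" "window y (a + int i) n = window y s n" by blast
      have "y (b + int i + int n) = y (a + int i + int n)"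
        using det[of s "b + int i"] det[of s "a + int i"] s IH ab by simp
      from window_step[OF IH this] Suc show ?thesis by (simp add: algebra_simps)
    qed
    have 2: "\<exists>s. a \<le> s \<and> s < b \<and> window y (a + int j) n = window y s n"
    proof (cases "a + int j < b")
      case True
      then show ?thesis by (intro exI[of _ "a + int j"]) auto
    next
      case False
      define i where "i = nat (a + int j - b)"
      have i: "a + int j = b + int i" "i < j" using False ab by (auto simp: i_def)
      show ?thesis using less[OF i(2)] i(1) by simp
    qed
    from 1 2 show ?case by blast
  qed
  from *[of "nat (t - a)"] t show "window y (t + (b - a)) n = window y t n"
    by (simp add: algebra_simps)
  from *[of "nat (t - a)"] t show "\<exists>s. a \<le> s \<and> s < b \<and> window y t n = window y s n"
    by simp
qed

lemma window_eq_hd: "window y s n = window y t n \<Longrightarrow> 0 < n \<Longrightarrow> y s = y t"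
  by (metis add.right_neutral nth_window of_nat_0)

text \<open>Pigeonhole: \<open>complexity X n + 1\<close> starting positions compete for
  \<open>complexity X n\<close> words.\<close>

lemma window_repeat:
  assumes "y \<in> X" "finite (words X n)"
  obtains a b where "t \<le> a" "a < b" "b \<le> t + int (complexity X n)" "window y a n = window y b n"
proof -
  let ?A = "{t..t + int (complexity X n)}"
  have "card ((\<lambda>s. window y s n) ` ?A) \<le> complexity X n"
    unfolding complexity_def by (rule card_mono[OF assms(2)]) (auto intro: window_in_words assms)
  also have "\<dots> < card ?A" by simp
  finally have "\<not> inj_on (\<lambda>s. window y s n) ?A" by (rule pigeonhole)
  then obtain a b where "a \<in> ?A" "b \<in> ?A" "a \<noteq> b" "window y a n = window y b n"
    by (auto simp: inj_on_def)
  then show thesis by (cases "a < b") (auto intro: that[of a b] that[of b a])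
qed

text \<open>A word that is not right special has only one continuation in all of \<open>X\<close>,
  so a repeat without right special words in between closes a cycle that \<open>y\<close> cannot
  leave; all later words lie on that cycle.\<close>

lemma no_right_special_periodic:
  assumes "y \<in> X" "a < b" "window y a n = window y b n"
    and "\<And>s. a \<le> s \<Longrightarrow> s < b \<Longrightarrow> \<not> right_special X n (window y s n)"
    and "a \<le> t"
  shows "window y (t + (b - a)) n = window y t n" "\<not> right_special X n (window y t n)"
proof -
  have det: "y (t + int n) = y (s + int n)"
    if "a \<le> s" "s < b" "window y t n = window y s n" for s t
    using not_right_special_unique[OF assms(4)[OF that(1,2)]] that(3) window_extend[OF assms(1)]
    by metis
  show "window y (t + (b - a)) n = window y t n"
    by (rule repeat_forces_periodicity(1)[OF assms(2,3) _ assms(5)]) (rule det)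
  have "\<exists>s. a \<le> s \<and> s < b \<and> window y t n = window y s n"
    by (rule repeat_forces_periodicity(2)[OF assms(2,3) _ assms(5)]) (rule det)
  then show "\<not> right_special X n (window y t n)" using assms(4) by metis
qed

text \<open>Within \<open>complexity X n\<close> steps some word repeats; if no right special word
  lay between the two occurrences, \<open>y\<close> would be periodic from there on.\<close>

lemma right_special_forward:
  assumes "y \<in> X" "finite (words X n)" "0 < n" "\<not> eventually_periodic y"
  obtains s where "t \<le> s" "s < t + int (complexity X n)" "right_special X n (window y s n)"
proof -
  obtain a b where ab: "t \<le> a" "a < b" "b \<le> t + int (complexity X n)" "window y a n = window y b n"
    using window_repeat[OF assms(1,2)] .
  have "\<exists>s. a \<le> s \<and> s < b \<and> right_special X n (window y s n)"
  proof (rule ccontr)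
    assume "\<not> ?thesis"
    then have "window y (t + (b - a)) n = window y t n" if "a \<le> t" for t
      using no_right_special_periodic(1)[OF assms(1) ab(2,4)] that by blast
    then have "y (t + (b - a)) = y t" if "a \<le> t" for t
      using window_eq_hd assms(3) that by blast
    then have "eventually_periodic y"
      unfolding eventually_periodic_def using ab(2) by (intro exI[of _ "b - a"]) auto
    with assms(4) show False ..
  qed
  then obtain s where "a \<le> s" "s < b" "right_special X n (window y s n)" by blast
  then show thesis using that[of s] ab by simp
qed

lemma periodic_multiple:
  assumes "\<And>t. T \<le> t \<Longrightarrow> y (t + p) = y t" "0 \<le> (p::int)" "T \<le> t"
  shows "y (t + p * int i) = y t"
proof (induction i)
  case (Suc i)
  have "T \<le> t + p * int i" using assms(2,3) by (simp add: add_increasing2)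
  from assms(1)[OF this] Suc show ?case by (simp add: algebra_simps)
qed simp

text \<open>Words repeat far to the left as well. Without right special words there, each repeat
  makes \<open>y\<close> periodic from that place on, with a period of at most
  \<open>complexity X n\<close>; starting places arbitrarily far left then give periodicity on the
  whole line.\<close>

lemma right_special_backward:
  assumes "y \<in> X" "finite (words X n)" "0 < n" "\<not> (\<exists>q>0. \<forall>t. y (t + q) = y t)"
  obtains s where "s \<le> T" "right_special X n (window y s n)"
proof (rule ccontr)
  assume "\<not> thesis"
  with that have no: "\<not> right_special X n (window y s n)" if "s \<le> T" for s using \<open>s \<le> T\<close> by blast
  let ?P = "complexity X n"
  \<comment> \<open>The period found depends on \<open>t\<close>; the factorial is a common multiple
    of all the possible ones.\<close>
  have "y (t + int (fact ?P)) = y t" for t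
  proof -
    define A where "A = min T t - int ?P"
    obtain a b where ab: "A \<le> a" "a < b" "b \<le> A + int ?P" "window y a n = window y b n"
      using window_repeat[OF assms(1,2)] .
    have "window y (t + (b - a)) n = window y t n" if "a \<le> t" for t
      using no_right_special_periodic(1)[OF assms(1) ab(2,4) _ that] no ab(3)
      by (force simp: A_def)
    then have per: "y (t + (b - a)) = y t" if "a \<le> t" for t
      using window_eq_hd assms(3) that by blast
    have "nat (b - a) dvd fact ?P" using ab by (intro dvd_fact) auto
    then obtain i where "fact ?P = nat (b - a) * i" by (elim dvdE)
    then have "int (fact ?P) = (b - a) * int i" using ab(2) by (metis of_nat_mult int_nat_eq diff_ge_0_iff_ge less_imp_le)
    moreover have "a \<le> t" using ab by (simp add: A_def)
    ultimately show ?thesis using periodic_multiple[of a y "b - a" t i, OF per] ab(2) by simp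
  qed
  then have "\<exists>q>0. \<forall>t. y (t + q) = y t"
    by (intro exI[of _ "int (fact ?P)"]) auto
  with assms(4) show False ..
qed

section \<open>Right special words and the growth of complexity\<close>

lemma sum_extensions:
  assumes "finite (words X n)" "finite (words X (Suc n))"
  defines "E \<equiv> \<lambda>w. {a. w @ [a] \<in> words X (Suc n)}"
  shows "complexity X (Suc n) = (\<Sum>w\<in>words X n. card (E w))"
    and "finite (E w)" and "w \<in> words X n \<Longrightarrow> 1 \<le> card (E w)"
proof -
  have fin: "finite (E w)" for w
    unfolding E_def by (rule finite_inverse_image[OF assms(2), unfolded vimage_def]) (auto simp: inj_def)
  then show "finite (E w)" .
  have "words X (Suc n) = (\<lambda>(w, a). w @ [a]) ` (SIGMA w:words X n. E w)"
  proof safe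
    fix v assume v: "v \<in> words X (Suc n)"
    then obtain y i where y: "y \<in> X" "v = window y i (Suc n)" by (auto simp: words_eq_windows)
    show "v \<in> (\<lambda>(w, a). w @ [a]) ` (SIGMA w:words X n. E w)"
      by (rule image_eqI[of _ _ "(window y i n, y (i + int n))"])
         (use y in \<open>auto simp: E_def window_Suc[symmetric] window_in_words\<close>)
  qed (auto simp: E_def)
  moreover have "inj_on (\<lambda>(w, a). w @ [a]) (SIGMA w:words X n. E w)"
    by (auto simp: inj_on_def)
  ultimately show "complexity X (Suc n) = (\<Sum>w\<in>words X n. card (E w))"
    unfolding complexity_def using assms(1) fin by (simp add: card_image)
  assume "w \<in> words X n"
  then obtain y i where y: "y \<in> X" "w = window y i n" by (auto simp: words_eq_windows)
  then have "y (i + int n) \<in> E w" by (auto simp: E_def window_extend)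
  with fin[of w] show "1 \<le> card (E w)" by (metis One_nat_def Suc_leI card_gt_0_iff empty_iff)
qed

lemma right_special_in_words: "right_special X n w \<Longrightarrow> w \<in> words X n"
  by (auto simp: right_special_def words_eq_windows window_Suc)

text \<open>The increase of the complexity is the sum, over the words of length \<open>n\<close>, of
  the number of continuations minus one. Every right special word contributes at least one, so those
  in \<open>R\<close> exhaust the allowance: no other word contributes, and each in \<open>R\<close>
  contributes exactly one.\<close>

lemma few_right_special:
  assumes fin: "finite (words X n)" "finite (words X (Suc n))"
    and growth: "complexity X (Suc n) \<le> complexity X n + card R"
    and R: "finite R" "\<And>w. w \<in> R \<Longrightarrow> right_special X n w"
    and w: "right_special X n w"
  shows "w \<in> R"
    and "w @ [a] \<in> words X (Suc n) \<Longrightarrow> w @ [b] \<in> words X (Suc n) \<Longrightarrow> w @ [c] \<in> words X (Suc n)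
          \<Longrightarrow> a = b \<or> b = c \<or> a = c"
proof -
  define E where "E = (\<lambda>w. {a. w @ [a] \<in> words X (Suc n)})"
  define f where "f = (\<lambda>w. card (E w) - 1)"
  have ext: "complexity X (Suc n) = (\<Sum>w\<in>words X n. card (E w))"
      "\<And>w. finite (E w)" "\<And>w. w \<in> words X n \<Longrightarrow> 1 \<le> card (E w)"
    using sum_extensions[OF fin] by (simp_all add: E_def)
  have "complexity X (Suc n) = (\<Sum>w\<in>words X n. f w + 1)"
    unfolding ext(1) f_def by (rule sum.cong) (use ext(3) in force)+
  also have "\<dots> = (\<Sum>w\<in>words X n. f w) + complexity X n"
    unfolding complexity_def sum.distrib by simp
  finally have le: "(\<Sum>w\<in>words X n. f w) \<le> card R" using growth by simp
  have one: "1 \<le> f v" if v: "right_special X n v" for v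
  proof -
    obtain a b where "a \<noteq> b" "{a, b} \<subseteq> E v" using v by (auto simp: right_special_def E_def)
    then have "2 \<le> card (E v)" using card_mono[OF ext(2), of "{a, b}" v] by simp
    then show ?thesis by (simp add: f_def)
  qed
  have bound: "(\<Sum>v\<in>insert w R. f v) \<le> card R"
  proof -
    have "(\<Sum>v\<in>insert w R. f v) \<le> (\<Sum>v\<in>words X n. f v)"
      by (rule sum_mono2[OF fin(1)]) (use R(2) w right_special_in_words in auto)
    with le show ?thesis by simp
  qed
  show wR: "w \<in> R"
  proof (rule ccontr)
    assume "w \<notin> R"
    have "(\<Sum>v\<in>insert w R. 1) \<le> (\<Sum>v\<in>insert w R. f v)"
      by (rule sum_mono) (use one R(2) w in auto)
    with bound \<open>w \<notin> R\<close> R(1) show False by simp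
  qed
  assume abc: "w @ [a] \<in> words X (Suc n)" "w @ [b] \<in> words X (Suc n)" "w @ [c] \<in> words X (Suc n)"
  show "a = b \<or> b = c \<or> a = c"
  proof (rule ccontr)
    assume "\<not> ?thesis"
    then have "card {a, b, c} = 3" by auto
    moreover have "{a, b, c} \<subseteq> E w" using abc by (auto simp: E_def)
    ultimately have "2 \<le> f w" using card_mono[OF ext(2), of "{a, b, c}" w] by (simp add: f_def)
    moreover have "card (R - {w}) \<le> (\<Sum>v\<in>R - {w}. f v)"
      unfolding card_eq_sum by (rule sum_mono) (use one R(2) in auto)
    moreover have "(\<Sum>v\<in>R. f v) = f w + (\<Sum>v\<in>R - {w}. f v)" using R(1) wR by (simp add: sum.remove)
    moreover have "card R = Suc (card (R - {w}))" using R(1) wR by (rule card.remove)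
    ultimately show False using bound[unfolded insert_absorb[OF wR]] by linarith
  qed
qed

section \<open>Forward closed sets in the Rauzy graph\<close>

lemma forward_closed_windows:
  assumes closed: "\<And>w a. w \<in> F \<Longrightarrow> w @ [a] \<in> words X (Suc n) \<Longrightarrow> tl (w @ [a]) \<in> F"
    and "y \<in> X" "window y s n \<in> F" "s \<le> t"
  shows "window y t n \<in> F"
  using assms(4)
proof (induction t rule: int_ge_induct)
  case base
  then show ?case using assms(3) .
next
  case (step i)
  then show ?case using closed[OF step(2) window_extend[OF assms(2)]] by (simp only: tl_window_extend)
qed

text \<open>Here \<open>L \<nu> w\<close> stands for ``\<open>w\<close> looks like \<open>\<nu>\<close>''.\<close>

lemma rauzy_graph_contradiction:
  fixes M :: "'m set" and z :: "'m \<Rightarrow> int \<Rightarrow> 'a" and x :: "int \<Rightarrow> 'a" and C :: int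
  assumes fin: "finite (words X n)" "finite (words X (Suc n))" and n: "0 < n"
    and M: "finite M" and growth: "complexity X (Suc n) \<le> complexity X n + card M"
    and x: "x \<in> X" "\<not> (\<exists>q>0. \<forall>t. x (t + q) = x t)"
    and z: "\<And>\<nu>. \<nu> \<in> M \<Longrightarrow> z \<nu> \<in> X" "\<And>\<nu>. \<nu> \<in> M \<Longrightarrow> \<not> eventually_periodic (z \<nu>)"
    and Lz: "\<And>\<nu> t. \<nu> \<in> M \<Longrightarrow> 0 \<le> t \<Longrightarrow> t \<le> C \<Longrightarrow> L \<nu> (window (z \<nu>) t n)"
    and Lx: "\<And>t. 0 \<le> t \<Longrightarrow> t \<le> C \<Longrightarrow> L \<mu> (window x t n)"
    and excl: "\<And>\<nu> \<nu>' w. \<nu> \<in> insert \<mu> M \<Longrightarrow> \<nu>' \<in> insert \<mu> M \<Longrightarrow> L \<nu> w \<Longrightarrow> L \<nu>' w \<Longrightarrow> \<nu> = \<nu>'"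
    and far: "\<not> L \<mu> (window x c n)"
    and esc: "\<And>\<nu> T. \<nu> \<in> M \<Longrightarrow> \<nu> \<noteq> \<mu> \<Longrightarrow> \<exists>t\<ge>T. \<not> L \<mu> (window (z \<nu>) t n)"
    and C: "2 * int (complexity X n) + 2 \<le> C"
    and branch: "\<mu> \<in> M \<Longrightarrow> z \<mu> = x \<and> (\<exists>s t. 0 \<le> s \<and> 0 \<le> t \<and>
        s + int (complexity X n) + 1 \<le> C \<and> t + int (complexity X n) + 1 \<le> C \<and>
        window x s n = window x t n \<and> x (s + int n) \<noteq> x (t + int n))"
  shows False
proof -
  let ?P = "int (complexity X n)" and ?rs = "right_special X n"
  have "\<exists>s. 0 \<le> s \<and> s < ?P \<and> ?rs (window (z \<nu>) s n)" if \<nu>: "\<nu> \<in> M" for \<nu>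
  proof -
    obtain s where "0 \<le> s" "s < 0 + ?P" "?rs (window (z \<nu>) s n)"
      by (rule right_special_forward[OF z(1)[OF \<nu>] fin(1) n z(2)[OF \<nu>], of 0])
    then show ?thesis by auto
  qed
  then obtain p where p: "\<And>\<nu>. \<nu> \<in> M \<Longrightarrow> 0 \<le> p \<nu> \<and> p \<nu> < ?P \<and> ?rs (window (z \<nu>) (p \<nu>) n)"
    by metis
  define v where "v \<nu> = window (z \<nu>) (p \<nu>) n" for \<nu>
  have v_rs: "?rs (v \<nu>)" and v_L: "L \<nu> (v \<nu>)" if "\<nu> \<in> M" for \<nu>
    using p[OF that] C Lz[OF that, of "p \<nu>"] by (auto simp: v_def)
  \<comment> \<open>Words that look like different measures differ, so the measures supply
    \<open>card M\<close> right special words. By the growth bound these are all, each with two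
    continuations.\<close>
  have "inj_on v M" by (rule inj_onI) (metis v_L excl insertI2)
  then have card_v: "card (v ` M) = card M" by (rule card_image)
  note few = few_right_special[OF fin growth[folded card_v]]
  have rs_v: "\<exists>\<nu>\<in>M. w = v \<nu>" if "?rs w" for w
    using few(1)[of w] M that v_rs by blast
  have two: "a = b \<or> b = c \<or> a = c"
    if "?rs w" "w @ [a] \<in> words X (Suc n)" "w @ [b] \<in> words X (Suc n)" "w @ [c] \<in> words X (Suc n)"
    for w a b c
    using few(2)[of w a b c] M that v_rs by blast
  have like_v: "\<nu> \<in> M \<and> w = v \<nu>" if "?rs w" "L \<nu> w" "\<nu> \<in> insert \<mu> M" for w \<nu>
    using rs_v[OF that(1)] excl that v_L by blast
  \<comment> \<open>\<open>D\<close> consists of \<open>v \<mu>\<close> and of what \<open>x\<close> reads, up to the next right special word, after each of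
    the two continuations of \<open>v \<mu>\<close>; all of this occurs near the origin, hence looks like \<open>\<mu>\<close>.\<close>
  obtain D where D: "\<And>w a. w \<in> D \<Longrightarrow> w @ [a] \<in> words X (Suc n) \<Longrightarrow> tl (w @ [a]) \<in> D"
      "\<And>w. w \<in> D \<Longrightarrow> L \<mu> w" "\<mu> \<in> M \<Longrightarrow> v \<mu> \<in> D"
  proof (cases "\<mu> \<in> M")
    case False
    show thesis by (rule that[of "{}"]) (use False in auto)
  next
    case True
    from branch[OF True] obtain s t where zx: "z \<mu> = x" and st: "0 \<le> s" "0 \<le> t"
        "s + ?P + 1 \<le> C" "t + ?P + 1 \<le> C" "window x s n = window x t n" "x (s + int n) \<noteq> x (t + int n)"
      by blast
    have "?rs (window x s n)"
      unfolding right_special_def using st(5,6) window_extend[OF x(1)] by metis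
    moreover have "L \<mu> (window x s n)" using Lx st by simp
    ultimately have v: "window x s n = v \<mu>" "window x t n = v \<mu>" using like_v st(5) by auto
    define J where "J = {j. \<exists>i\<in>{s, t}. i < j \<and> (\<forall>j'. i < j' \<and> j' < j \<longrightarrow> \<not> ?rs (window x j' n))}"
    define D where "D = insert (v \<mu>) ((\<lambda>j. window x j n) ` J)"
    \<comment> \<open>The next right special word comes within \<open>?P\<close> steps, so
      \<open>J\<close> stays in the range up to \<open>C\<close> where \<open>x\<close> looks like
      \<open>\<mu>\<close>.\<close>
    have J: "0 \<le> j \<and> j \<le> C" if "j \<in> J" for j
    proof -
      obtain i where i: "i \<in> {s, t}" "i < j" "\<forall>j'. i < j' \<and> j' < j \<longrightarrow> \<not> ?rs (window x j' n)"
        using \<open>j \<in> J\<close> by (auto simp: J_def)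
      obtain r where r: "i + 1 \<le> r" "r < i + 1 + ?P" "?rs (window x r n)"
        by (rule right_special_forward[OF x(1) fin(1) n z(2)[OF True, unfolded zx], of "i + 1"])
      with i(3) have "j \<le> r" by force
      with i(1,2) r st show ?thesis by auto
    qed
    have LD: "L \<mu> w" if "w \<in> D" for w using that J Lx v_L[OF True] by (auto simp: D_def)
    show thesis
    proof (rule that[of D])
      fix w a assume wD: "w \<in> D" and wa: "w @ [a] \<in> words X (Suc n)"
      \<comment> \<open>At \<open>v \<mu>\<close> the path takes one of the two letters seen in
        \<open>x\<close>; elsewhere the letter is forced. Either way it follows
        \<open>x\<close>.\<close>
      show "tl (w @ [a]) \<in> D"
      proof (cases "?rs w")
        case rs: True
        then have w: "w = v \<mu>" using like_v LD wD by blast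
        have "a = x (s + int n) \<or> a = x (t + int n)"
          using two[OF rs wa, of "x (s + int n)" "x (t + int n)"] st(6) w v
            window_extend[OF x(1), of s n] window_extend[OF x(1), of t n] by auto
        then have "tl (w @ [a]) = window x (s + 1) n \<or> tl (w @ [a]) = window x (t + 1) n"
          using tl_window_extend w v by metis
        moreover have "s + 1 \<in> J" "t + 1 \<in> J" by (auto simp: J_def)
        ultimately show ?thesis by (auto simp: D_def)
      next
        case nrs: False
        then have "w \<noteq> v \<mu>" using v_rs True by auto
        then obtain j where j: "j \<in> J" "w = window x j n" using wD by (auto simp: D_def)
        then have "a = x (j + int n)"
          using not_right_special_unique[OF nrs wa] window_extend[OF x(1)] by blast
        then have "tl (w @ [a]) = window x (j + 1) n" using j tl_window_extend by metis
        moreover have "j + 1 \<in> J"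
        proof -
          obtain i where i: "i \<in> {s, t}" "i < j" "\<forall>j'. i < j' \<and> j' < j \<longrightarrow> \<not> ?rs (window x j' n)"
            using \<open>j \<in> J\<close> by (auto simp: J_def)
          have "\<not> ?rs (window x j' n)" if "i < j'" "j' < j + 1" for j'
            using i(3) that nrs j(2) by (cases "j' = j") auto
          then show ?thesis using i(1,2) unfolding J_def by force
        qed
        ultimately show ?thesis by (auto simp: D_def)
      qed
    qed (use LD in \<open>auto simp: D_def\<close>)
  qed
  have D_rs: "\<mu> \<in> M \<and> w = v \<mu>" if "w \<in> D" "?rs w" for w
    using like_v D(2) that by blast
  \<comment> \<open>The times at which \<open>x\<close> reads a right special word other than
    \<open>v \<mu>\<close>, where \<open>v \<mu>\<close> counts only if
    \<open>\<mu> \<in> M\<close>. The aim is \<open>B = {}\<close>.\<close>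
  define B where "B = {s. ?rs (window x s n) \<and> \<not> (\<mu> \<in> M \<and> window x s n = v \<mu>)}"
  \<comment> \<open>For \<open>\<mu>\<close> in \<open>M\<close> the point \<open>x\<close> enters
    \<open>D\<close> and stays there. Otherwise no right special word looks like
    \<open>\<mu>\<close>, so \<open>x\<close> meets none up to \<open>C\<close>, is caught in a
    cycle and meets none later.\<close>
  have B_bounded: "\<exists>T. \<forall>s\<in>B. s < T"
  proof (cases "\<mu> \<in> M")
    case True
    then have "z \<mu> = x" using branch by blast
    then have "window x (p \<mu>) n \<in> D" using D(3) True by (simp add: v_def)
    then have *: "window x s n \<in> D" if "p \<mu> \<le> s" for s
      using forward_closed_windows[OF D(1) x(1)] that by blast
    have "s < p \<mu>" if s: "s \<in> B" for s
    proof (rule ccontr)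
      assume "\<not> s < p \<mu>"
      then have "window x s n \<in> D" by (intro *) simp
      from D_rs[OF this] s show False unfolding B_def by blast
    qed
    then show ?thesis by blast
  next
    case False
    have no: "\<not> ?rs (window x s n)" if "0 \<le> s" "s \<le> C" for s
      using like_v[of "window x s n" \<mu>] Lx that False by blast
    obtain a b where ab: "0 \<le> a" "a < b" "b \<le> 0 + ?P" "window x a n = window x b n"
      using window_repeat[OF x(1) fin(1)] .
    have no': "\<not> ?rs (window x s n)" if "a \<le> s" "s < b" for s
      by (rule no) (use that ab C in linarith)+
    have "s < a" if s: "s \<in> B" for s
    proof (rule ccontr)
      assume "\<not> s < a"
      then have "a \<le> s" by simp
      from no_right_special_periodic(2)[OF x(1) ab(2,4) no' this] s
      show False unfolding B_def by blast
    qed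
    then show ?thesis by blast
  qed
  have B_empty: "B = {}"
  proof (rule ccontr)
    assume "B \<noteq> {}"
    then obtain s0 where s0: "s0 \<in> B" by auto
    obtain T where T: "\<And>s. s \<in> B \<Longrightarrow> s < T" using B_bounded by blast
    define q where "q = Max (B \<inter> {s0..T})"
    have "q \<in> B \<inter> {s0..T}" unfolding q_def by (rule Max_in) (use s0 T in force)+
    then have q: "q \<in> B" by simp
    have q_max: "s \<le> q" if "s \<in> B" for s
    proof (cases "s0 \<le> s")
      case True
      then show ?thesis unfolding q_def by (intro Max_ge) (use that T in force)+
    next
      case False
      then show ?thesis using \<open>q \<in> B \<inter> {s0..T}\<close> by simp
    qed
    from q obtain \<nu> where \<nu>: "\<nu> \<in> M" "window x q n = v \<nu>" "\<nu> \<noteq> \<mu>"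
      using rs_v unfolding B_def by blast
    \<comment> \<open>\<open>q\<close> is the last time at which \<open>x\<close> reads a right special word other than \<open>v \<mu>\<close>.\<close>
    define F where "F = {window x t n | t. q < t} \<union> D"
    have F_rs: "\<mu> \<in> M \<and> w = v \<mu>" if "w \<in> F" "?rs w" for w
    proof (cases "w \<in> D")
      case False
      then obtain t where "q < t" "w = window x t n" using \<open>w \<in> F\<close> by (auto simp: F_def)
      then show ?thesis using q_max[of t] that(2) by (auto simp: B_def)
    qed (use D_rs that in auto)
    \<comment> \<open>The path of \<open>x\<close> after \<open>q\<close> can be left only at a
      right special word, and the only one on it is \<open>v \<mu>\<close>, where \<open>D\<close>
      takes over.\<close>
    have F_closed: "tl (w @ [a]) \<in> F" if "w \<in> F" "w @ [a] \<in> words X (Suc n)" for w a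
    proof (cases "w \<in> D")
      case True
      then show ?thesis using D(1) that(2) by (auto simp: F_def)
    next
      case False
      then obtain t where t: "q < t" "w = window x t n" using \<open>w \<in> F\<close> by (auto simp: F_def)
      have "\<not> ?rs w" using F_rs[OF \<open>w \<in> F\<close>] D(3) False by blast
      then have "a = x (t + int n)"
        using not_right_special_unique[OF _ that(2)] window_extend[OF x(1)] t by blast
      then have "tl (w @ [a]) = window x (t + 1) n" using t tl_window_extend by metis
      moreover have "q < t + 1" using t by simp
      ultimately show ?thesis unfolding F_def by blast
    qed
    \<comment> \<open>By taking the letter of \<open>x\<close>, \<open>z \<nu>\<close> would follow
      \<open>F\<close> to the next right special word, which lies in \<open>D\<close>, and then look
      like \<open>\<mu>\<close> for ever, against \<open>esc\<close>.\<close>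
    have avoid: "z \<nu> (t + int n) \<noteq> x (q + int n)" if t: "window (z \<nu>) t n = v \<nu>" for t
    proof
      assume "z \<nu> (t + int n) = x (q + int n)"
      then have "window (z \<nu>) (t + 1) n = window x (q + 1) n"
        using window_step t \<nu>(2) by metis
      then have inF: "window (z \<nu>) (t + 1) n \<in> F" unfolding F_def by force
      obtain s where s: "t + 1 \<le> s" "s < t + 1 + ?P" "?rs (window (z \<nu>) s n)"
        by (rule right_special_forward[OF z(1)[OF \<nu>(1)] fin(1) n z(2)[OF \<nu>(1)], of "t + 1"])
      have "window (z \<nu>) s n \<in> F"
        using forward_closed_windows[OF F_closed z(1)[OF \<nu>(1)] inF s(1)] .
      then have "window (z \<nu>) s n \<in> D" using F_rs s(3) D(3) by metis
      then have "window (z \<nu>) s' n \<in> D" if "s \<le> s'" for s'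
        using forward_closed_windows[OF D(1) z(1)[OF \<nu>(1)]] that by blast
      then show False using esc[OF \<nu>(1,3), of s] D(2) by blast
    qed
    obtain r where r: "p \<nu> + 1 \<le> r" "r < p \<nu> + 1 + ?P" "?rs (window (z \<nu>) r n)"
      by (rule right_special_forward[OF z(1)[OF \<nu>(1)] fin(1) n z(2)[OF \<nu>(1)], of "p \<nu> + 1"])
    \<comment> \<open>Times up to \<open>r\<close> lie below \<open>C\<close>, where
      \<open>z \<nu>\<close> looks like \<open>\<nu>\<close>; hence its right special words there
      are all \<open>v \<nu>\<close>.\<close>
    have early: "window (z \<nu>) s n = v \<nu>" if "p \<nu> \<le> s" "s \<le> r" "?rs (window (z \<nu>) s n)" for s
      using like_v[OF that(3), of \<nu>] Lz[OF \<nu>(1), of s] that(1,2) r(2) p[OF \<nu>(1)] C \<nu>(1) by simp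
    have rep: "window (z \<nu>) (p \<nu>) n = window (z \<nu>) r n" using early[of r] r by (simp add: v_def)
    have det: "z \<nu> (t + int n) = z \<nu> (s + int n)"
      if "p \<nu> \<le> s" "s < r" "p \<nu> \<le> t" "window (z \<nu>) t n = window (z \<nu>) s n" for s t
    proof (cases "?rs (window (z \<nu>) s n)")
      case False
      then show ?thesis
        using not_right_special_unique[OF False] that(4) window_extend[OF z(1)[OF \<nu>(1)]] by metis
    next
      case True
      then have *: "window (z \<nu>) s n = v \<nu>" "window (z \<nu>) t n = v \<nu>" using early[of s] that by auto
      \<comment> \<open>\<open>v \<nu>\<close> has two continuations and one is avoided, so
        \<open>z \<nu>\<close> always takes the other.\<close>
      have "v \<nu> @ [z \<nu> (t + int n)] \<in> words X (Suc n)" "v \<nu> @ [z \<nu> (s + int n)] \<in> words X (Suc n)"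
        "v \<nu> @ [x (q + int n)] \<in> words X (Suc n)"
        using * \<nu>(2) window_extend[OF z(1)[OF \<nu>(1)]] window_extend[OF x(1)] by metis+
      from two[OF v_rs[OF \<nu>(1)] this] avoid[OF *(1)] avoid[OF *(2)] show ?thesis by auto
    qed
    have "window (z \<nu>) (t + (r - p \<nu>)) n = window (z \<nu>) t n" if "p \<nu> \<le> t" for t
    proof (rule repeat_forces_periodicity(1)[OF _ rep _ that])
      show "p \<nu> < r" using r(1) by simp
    qed (rule det)
    then have "z \<nu> (t + (r - p \<nu>)) = z \<nu> t" if "p \<nu> \<le> t" for t
      using window_eq_hd n that by blast
    then have "eventually_periodic (z \<nu>)"
      unfolding eventually_periodic_def using r(1) by (intro exI[of _ "r - p \<nu>"]) auto
    with z(2)[OF \<nu>(1)] show False ..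
  qed
  \<comment> \<open>With \<open>B\<close> empty, a right special word to the left of
    \<open>c\<close> can only be \<open>v \<mu>\<close>; from it \<open>x\<close> stays in
    \<open>D\<close> up to \<open>c\<close>, where it was supposed not to look like
    \<open>\<mu>\<close>.\<close>
  obtain s where s: "s \<le> c" "?rs (window x s n)"
    using right_special_backward[OF x(1) fin(1) n x(2)] .
  with B_empty have "\<mu> \<in> M" "window x s n = v \<mu>" by (auto simp: B_def)
  then have "window x s n \<in> D" using D(3) by simp
  then have "window x c n \<in> D" using forward_closed_windows[OF D(1) x(1) _ s(1)] by blast
  then show False using D(2) far by blast
qed

section \<open>Cylinder sets and word frequencies\<close>

definition cylinder :: "int \<Rightarrow> 'a list \<Rightarrow> (int \<Rightarrow> 'a) set" where
  "cylinder t u = {y. window y t (length u) = u}"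

definition mass :: "(int \<Rightarrow> 'a) measure \<Rightarrow> 'a list \<Rightarrow> real" where
  "mass \<nu> u = measure \<nu> (cylinder 0 u \<inter> space \<nu>)"

text \<open>
  Intended for \<open>length u \<le> l\<close>: discarding the last \<open>l\<close> positions, the same number for all words
  \<open>u\<close> under consideration, ensures that every inspected occurrence lies inside \<open>w\<close>.
\<close>

definition freq :: "nat \<Rightarrow> 'a list \<Rightarrow> 'a list \<Rightarrow> real" where
  "freq l u w = (\<Sum>j<length w - l. of_bool (take (length u) (drop j w) = u)) / real (length w)"

definition centered_box :: "nat \<Rightarrow> (int \<Rightarrow> 'a) \<Rightarrow> (int \<Rightarrow> 'a) set" where
  "centered_box p x = {y. \<forall>i\<in>{- int p..int p}. y i = x i}"

section \<open>Topology of the shift space\<close>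

lemma open_cylinder: "open (cylinder t u :: (int \<Rightarrow> 'a::discrete_topology) set)"
proof -
  have "cylinder t u = {y. \<forall>i\<in>{..<length u}. y (t + int i) \<in> {u ! i}}"
    by (auto simp: cylinder_def list_eq_iff_nth_eq)
  also have "open \<dots>" by (rule product_topology_basis') (auto intro: open_discrete)
  finally show ?thesis .
qed

lemma centered_box_eq_cylinder: "centered_box p x = cylinder (- int p) (window x (- int p) (2 * p + 1))"
proof -
  have "(\<forall>i\<in>{- int p..int p}. y i = x i) \<longleftrightarrow>
        (\<forall>j<2 * p + 1. y (- int p + int j) = x (- int p + int j))" for y
  proof safe
    fix i assume *: "\<forall>j<2 * p + 1. y (- int p + int j) = x (- int p + int j)" and i: "i \<in> {- int p..int p}"
    show "y i = x i" using *[rule_format, of "nat (i + int p)"] i by auto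
  qed auto
  then show ?thesis by (simp add: centered_box_def cylinder_def list_eq_iff_nth_eq)
qed

lemma open_centered_box: "open (centered_box p x :: (int \<Rightarrow> 'a::discrete_topology) set)"
  unfolding centered_box_eq_cylinder by (rule open_cylinder)

text \<open>Such a function is locally constant, since fixing the coordinates in \<open>I\<close> is
  an open condition.\<close>

lemma continuous_on_finite_coordinates:
  fixes f :: "(int \<Rightarrow> 'a::discrete_topology) \<Rightarrow> 'b::topological_space"
  assumes "finite I" "\<And>y y'. (\<And>i. i \<in> I \<Longrightarrow> y i = y' i) \<Longrightarrow> f y = f y'"
  shows "continuous_on S f"
  unfolding continuous_on_def
proof
  fix y assume "y \<in> S"
  have "open {y'. \<forall>i\<in>I. y' i \<in> {y i}}"
    by (rule product_topology_basis'[where x = "\<lambda>i. i"]) (use assms(1) in \<open>auto intro: open_discrete\<close>)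
  then have "eventually (\<lambda>y'. f y' = f y) (at y within S)"
    unfolding eventually_at_topological
    by (intro exI[of _ "{y'. \<forall>i\<in>I. y' i \<in> {y i}}"]) (auto intro: assms(2))
  then show "(f \<longlongrightarrow> f y) (at y within S)" by (rule tendsto_eventually)
qed

text \<open>A basic open set of the product restricts finitely many coordinates, and a large centred
  range contains them all.\<close>

lemma open_contains_box:
  fixes U :: "(int \<Rightarrow> 'a::discrete_topology) set"
  assumes "open U" "y \<in> U"
  obtains p where "centered_box p y \<subseteq> U"
proof -
  obtain V where V: "y \<in> Pi\<^sub>E UNIV V" "finite {i. V i \<noteq> UNIV}" "Pi\<^sub>E UNIV V \<subseteq> U"
    using product_topology_open_contains_basis[of "\<lambda>i::int. euclidean" UNIV U y] assms
    by (auto simp: open_fun_def)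
  define p where "p = Max (insert 0 ((\<lambda>i. nat \<bar>i\<bar>) ` {i. V i \<noteq> UNIV}))"
  have p: "\<bar>i\<bar> \<le> int p" if "V i \<noteq> UNIV" for i
  proof -
    have "nat \<bar>i\<bar> \<le> p" unfolding p_def by (rule Max_ge) (use V(2) that in auto)
    then show ?thesis by simp
  qed
  have "centered_box p y \<subseteq> Pi\<^sub>E UNIV V"
  proof
    fix y' assume y': "y' \<in> centered_box p y"
    have "y' i \<in> V i" for i
    proof (cases "V i = UNIV")
      case False
      then have "y' i = y i" using y' p[OF False] by (simp add: centered_box_def abs_le_iff)
      then show ?thesis using V(1) by auto
    qed simp
    then show "y' \<in> Pi\<^sub>E UNIV V" by auto
  qed
  with V(3) show thesis using that by blast
qed

section \<open>A countable generator of the Borel sets\<close>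

lemma finite_words:
  assumes "X \<subseteq> UNIV \<rightarrow> A" "finite A"
  shows "finite (words X n)"
proof (rule finite_subset)
  show "words X n \<subseteq> {w. set w \<subseteq> A \<and> length w = n}"
    using assms(1) by (fastforce simp: words_def)
  show "finite {w. set w \<subseteq> A \<and> length w = n}" using assms(2) by (rule finite_lists_length_eq)
qed

text \<open>Centres are taken in \<open>X\<close> so that the boxes are indexed by words of
  \<open>X\<close>; the empty set makes the family stable under intersection.\<close>

definition boxes :: "(int \<Rightarrow> 'a) set \<Rightarrow> (int \<Rightarrow> 'a) set set" where
  "boxes X = insert {} {centered_box p x \<inter> X | p x. x \<in> X}"

lemma countable_boxes:
  assumes "\<And>n. finite (words X n)"
  shows "countable (boxes X)"
proof -
  have "boxes X \<subseteq> insert {} ((\<lambda>(p, w). cylinder (- int p) w \<inter> X) ` (SIGMA p:UNIV. words X (2 * p + 1)))"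
    by (force simp: boxes_def centered_box_eq_cylinder intro: window_in_words)
  moreover have "countable (SIGMA p:UNIV. words X (2 * p + 1))"
    by (intro countable_SIGMA countableI_type countable_finite assms)
  ultimately show ?thesis by (meson countable_image countable_insert countable_subset)
qed

lemma open_Int_eq_Union_boxes:
  fixes U :: "(int \<Rightarrow> 'a::discrete_topology) set"
  assumes "open U"
  shows "U \<inter> X = \<Union>{B \<in> boxes X. B \<subseteq> U}"
proof safe
  fix y assume y: "y \<in> U" "y \<in> X"
  obtain p where "centered_box p y \<subseteq> U" using open_contains_box[OF assms y(1)] .
  then have "centered_box p y \<inter> X \<in> {B \<in> boxes X. B \<subseteq> U}" using y by (auto simp: boxes_def)
  moreover have "y \<in> centered_box p y \<inter> X" using y by (simp add: centered_box_def)
  ultimately show "y \<in> \<Union>{B \<in> boxes X. B \<subseteq> U}" by blast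
qed (auto simp: boxes_def)

text \<open>Two centred boxes with a common point are nested, because both index ranges are
  symmetric about 0.\<close>

lemma Int_stable_boxes: "Int_stable (boxes X)"
proof (rule Int_stableI)
  have *: "centered_box p x \<inter> X \<inter> (centered_box q x' \<inter> X) \<in> boxes X" if "p \<le> q" "x' \<in> X" for p q x x'
  proof (cases "centered_box p x \<inter> X \<inter> (centered_box q x' \<inter> X) = {}")
    case False
    then obtain y where "y \<in> centered_box p x" "y \<in> centered_box q x'" by auto
    moreover have "{- int p..int p} \<subseteq> {- int q..int q}" using that by auto
    ultimately have "centered_box q x' \<subseteq> centered_box p x" by (force simp: centered_box_def)
    then show ?thesis using that by (auto simp: boxes_def)
  qed (simp add: boxes_def)
  fix a b assume "a \<in> boxes X" "b \<in> boxes X"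
  then show "a \<inter> b \<in> boxes X"
    unfolding boxes_def insert_iff mem_Collect_eq
  proof (elim disjE exE conjE)
    fix p x q x' assume h: "a = centered_box p x \<inter> X" "x \<in> X" "b = centered_box q x' \<inter> X" "x' \<in> X"
    have "a \<inter> b \<in> boxes X"
    proof (cases "p \<le> q")
      case True
      then show ?thesis using *[of p q x' x] h by simp
    next
      case False
      then show ?thesis using *[of q p x x'] h by (simp add: Int_commute)
    qed
    then show "a \<inter> b = {} \<or> (\<exists>p x. a \<inter> b = centered_box p x \<inter> X \<and> x \<in> X)" by (auto simp: boxes_def)
  qed auto
qed

text \<open>Every relatively open set is a union of boxes, and there are only countably many of
  them.\<close>

lemma sets_restrict_borel_boxes:
  fixes X :: "(int \<Rightarrow> 'a::discrete_topology) set"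
  assumes "\<And>n. finite (words X n)"
  shows "sets (restrict_space borel X) = sigma_sets X (boxes X)"
proof
  interpret S: sigma_algebra X "sigma_sets X (boxes X)"
    by (rule sigma_algebra_sigma_sets) (auto simp: boxes_def)
  have "B \<inter> X \<in> sigma_sets X (boxes X)" if "B \<in> sigma_sets UNIV {S. open S}" for B
    using that
  proof induction
    case (Basic U)
    then have "U \<inter> X = \<Union>{B \<in> boxes X. B \<subseteq> U}" using open_Int_eq_Union_boxes by blast
    also have "\<dots> \<in> sigma_sets X (boxes X)"
      by (rule S.countable_Union) (auto intro: countable_subset[OF _ countable_boxes[OF assms]])
    finally show ?case .
  next
    case (Compl B)
    have "(UNIV - B) \<inter> X = X - B \<inter> X" by auto
    with Compl show ?case by (simp add: S.compl_sets)
  next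
    case (Union B)
    have "\<Union> (range B) \<inter> X = (\<Union>i. B i \<inter> X)" by auto
    moreover have "(\<Union>i. B i \<inter> X) \<in> sigma_sets X (boxes X)"
      by (rule S.countable_UN) (use Union in auto)
    ultimately show ?case by simp
  qed simp
  then show "sets (restrict_space borel X) \<subseteq> sigma_sets X (boxes X)"
    by (auto simp: sets_restrict_space borel_def Int_commute)
  have "B \<in> sets (restrict_space borel X)" if B: "B \<in> boxes X" for B
  proof -
    consider "B = {}" | p x where "B = centered_box p x \<inter> X"
      using B unfolding boxes_def by blast
    then show ?thesis
    proof cases
      case 2
      have "X \<inter> centered_box p x \<in> (\<inter>) X ` sets borel"
        by (rule imageI) (rule borel_open[OF open_centered_box])
      then show ?thesis by (simp only: 2 sets_restrict_space Int_commute)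
    qed simp
  qed
  then have "boxes X \<subseteq> sets (restrict_space borel X)" by blast
  from sets.sigma_sets_subset[OF this]
  show "sigma_sets X (boxes X) \<subseteq> sets (restrict_space borel X)"
    by (simp add: space_restrict_space)
qed

section \<open>Invariant measures and the masses of words\<close>

lemma invariant_measureD:
  assumes "invariant_measure X \<nu>"
  shows "prob_space \<nu>" "space \<nu> = X" "open U \<Longrightarrow> U \<inter> X \<in> sets \<nu>"
    "sets \<nu> = sets (restrict_space borel X)"
    "shift \<in> measurable \<nu> \<nu>" "distr \<nu> \<nu> shift = \<nu>"
proof -
  show s: "sets \<nu> = sets (restrict_space borel X)" using assms by (simp add: invariant_measure_def)
  show "space \<nu> = X" using sets_eq_imp_space_eq[OF s] by (simp add: space_restrict_space)
  show "open U \<Longrightarrow> U \<inter> X \<in> sets \<nu>" unfolding s by (auto simp: sets_restrict_space)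
qed (use assms in \<open>simp_all add: invariant_measure_def\<close>)

lemma window_shift: "window (shift y) t n = window y (t + 1) n"
  by (simp add: window_def shift_def algebra_simps)

lemma shift_funpow: "(shift ^^ n) y = (\<lambda>i. y (i + int n))"
  by (induction n arbitrary: y) (auto simp: shift_def algebra_simps)

lemma window_shift_funpow: "window ((shift ^^ m) y) t n = window y (t + int m) n"
  by (simp add: window_def shift_funpow algebra_simps)

text \<open>Invariance moves the cylinder by one position; induction in both directions reaches
  every integer.\<close>

lemma measure_cylinder:
  assumes "invariant_measure X \<nu>"
  shows "measure \<nu> (cylinder t u \<inter> X) = mass \<nu> u"
proof -
  note inv = invariant_measureD[OF assms]
  have step: "measure \<nu> (cylinder (t + 1) u \<inter> X) = measure \<nu> (cylinder t u \<inter> X)" for t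
  proof -
    have "measure \<nu> (cylinder t u \<inter> X) = measure (distr \<nu> \<nu> shift) (cylinder t u \<inter> X)"
      by (simp add: inv(6))
    also have "\<dots> = measure \<nu> (shift -` (cylinder t u \<inter> X) \<inter> space \<nu>)"
      by (rule measure_distr[OF inv(5)]) (rule inv(3)[OF open_cylinder])
    also have "shift -` (cylinder t u \<inter> X) \<inter> space \<nu> = cylinder (t + 1) u \<inter> X"
      using measurable_space[OF inv(5)] by (auto simp: cylinder_def window_shift inv(2))
    finally show ?thesis by simp
  qed
  have "measure \<nu> (cylinder t u \<inter> X) = measure \<nu> (cylinder 0 u \<inter> X)"
  proof (induction t rule: int_induct[of _ 0])
    case (step2 i)
    then show ?case using step[of "i - 1"] by simp
  qed (simp_all add: step)
  then show ?thesis by (simp add: mass_def inv(2))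
qed

text \<open>The masses give the measures of all boxes, which form a countable, intersection-stable
  generator covering \<open>X\<close>.\<close>

lemma invariant_measure_eqI:
  fixes X :: "(int \<Rightarrow> 'a::discrete_topology) set"
  assumes fin: "\<And>n. finite (words X n)"
    and inv: "invariant_measure X \<nu>" "invariant_measure X \<nu>'"
    and eq: "\<And>u. mass \<nu> u = mass \<nu>' u"
  shows "\<nu> = \<nu>'"
proof (rule measure_eqI_generator_eq_countable[OF Int_stable_boxes])
  interpret \<nu>: prob_space \<nu> using invariant_measureD(1)[OF inv(1)] .
  interpret \<nu>': prob_space \<nu>' using invariant_measureD(1)[OF inv(2)] .
  show "boxes X \<subseteq> Pow X" by (auto simp: boxes_def)
  show "emeasure \<nu> B = emeasure \<nu>' B" if "B \<in> boxes X" for B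
    using that eq measure_cylinder[OF inv(1)] measure_cylinder[OF inv(2)]
    by (auto simp: boxes_def centered_box_eq_cylinder \<nu>.emeasure_eq_measure \<nu>'.emeasure_eq_measure)
  show "sets \<nu> = sigma_sets X (boxes X)" "sets \<nu>' = sigma_sets X (boxes X)"
    using inv by (simp_all add: invariant_measureD(4) sets_restrict_borel_boxes[OF fin])
  show "\<Union>(boxes X) = X" using open_Int_eq_Union_boxes[of UNIV X] by simp
  show "countable (boxes X)" by (rule countable_boxes[OF fin])
  show "emeasure \<nu> B \<noteq> \<infinity>" if "B \<in> boxes X" for B
    using \<nu>.emeasure_finite by simp
qed simp

section \<open>Subword frequencies in windows\<close>

lemma take_drop_window: "j + m \<le> n \<Longrightarrow> take m (drop j (window y t n)) = window y (t + int j) m"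
  by (rule nth_equalityI) (auto simp: algebra_simps)

lemma freq_window:
  assumes "length u \<le> l"
  shows "freq l u (window y t n) = (\<Sum>j<n - l. indicator (cylinder (t + int j) u) y) / real n"
proof -
  have "(\<Sum>j<n - l. of_bool (take (length u) (drop j (window y t n)) = u) :: real)
      = (\<Sum>j<n - l. indicator (cylinder (t + int j) u) y)"
    by (rule sum.cong) (use assms in \<open>auto simp: take_drop_window cylinder_def indicator_def\<close>)
  then show ?thesis by (simp add: freq_def)
qed

text \<open>The frequency is a sum of \<open>n - l\<close> cylinder indicators divided by
  \<open>n\<close>, not by \<open>n - l\<close>; hence the factor.\<close>

lemma
  assumes inv: "invariant_measure X \<nu>" and u: "length u \<le> l"
  shows integrable_freq: "integrable \<nu> (\<lambda>y. freq l u (window y t n))"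
    and integral_freq: "(\<integral>y. freq l u (window y t n) \<partial>\<nu>) = real (n - l) / real n * mass \<nu> u"
proof -
  note D = invariant_measureD[OF inv]
  interpret prob_space \<nu> by (rule D(1))
  have int: "integrable \<nu> (indicator (cylinder s u) :: _ \<Rightarrow> real)" for s
    by (simp add: integrable_indicator_iff D(2) D(3)[OF open_cylinder] emeasure_eq_measure)
  then show "integrable \<nu> (\<lambda>y. freq l u (window y t n))"
    unfolding freq_window[OF u]
    by (intro integrable_divide_zero Bochner_Integration.integrable_sum int)
  have "(\<integral>y. freq l u (window y t n) \<partial>\<nu>)
      = (\<Sum>j<n - l. \<integral>y. indicator (cylinder (t + int j) u) y \<partial>\<nu>) / real n"
    unfolding freq_window[OF u] using int by (simp add: integral_sum)
  also have "\<dots> = real (n - l) / real n * mass \<nu> u"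
    using measure_cylinder[OF inv] by (simp add: D(2))
  finally show "(\<integral>y. freq l u (window y t n) \<partial>\<nu>) = real (n - l) / real n * mass \<nu> u" .
qed

section \<open>Averages along generic points\<close>

lemma window_cong: "(\<And>i. i \<in> {t..<t + int n} \<Longrightarrow> y i = y' i) \<Longrightarrow> window y t n = window y' t n"
  by (auto simp: window_def)

lemma continuous_on_window:
  fixes f :: "'a::discrete_topology list \<Rightarrow> 'b::topological_space"
  shows "continuous_on S (\<lambda>y. f (window y t n))"
proof (rule continuous_on_finite_coordinates[of "{t..<t + int n}"])
  fix y y' :: "int \<Rightarrow> 'a" assume "\<And>i. i \<in> {t..<t + int n} \<Longrightarrow> y i = y' i"
  then show "f (window y t n) = f (window y' t n)" using window_cong[of t n y y'] by simp
qed simp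

text \<open>The first \<open>T\<close> terms contribute at most \<open>K / real N\<close> to the
  average, which vanishes in the limit. With \<open>e = 0\<close> the integral is obtained
  exactly.\<close>

lemma generic_point_tail:
  fixes f :: "(int \<Rightarrow> 'a::discrete_topology) \<Rightarrow> real"
  assumes "generic_point X \<nu> z" "continuous_on X f"
    and tail: "\<And>t. T \<le> t \<Longrightarrow> \<bar>f ((shift ^^ t) z) - b\<bar> \<le> e"
  shows "\<bar>(\<integral>y. f y \<partial>\<nu>) - b\<bar> \<le> e"
proof -
  define g where "g t = f ((shift ^^ t) z) - b" for t
  define K where "K = (\<Sum>t<T. \<bar>g t\<bar>)"
  have e: "0 \<le> e" using tail[of T] by simp
  have lim: "(\<lambda>N. 1 / real N * (\<Sum>n<N. f ((shift ^^ n) z))) \<longlonglongrightarrow> (\<integral>y. f y \<partial>\<nu>)"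
    using assms(1,2) by (auto simp: generic_point_def)
  have sum: "\<bar>\<Sum>t<N. g t\<bar> \<le> K + real N * e" for N
  proof -
    have "\<bar>\<Sum>t<N. g t\<bar> \<le> (\<Sum>t<N. \<bar>g t\<bar>)" by (rule sum_abs)
    also have "\<dots> \<le> (\<Sum>t<N. (if t < T then \<bar>g t\<bar> else 0) + e)"
      by (rule sum_mono) (use tail e in \<open>auto simp: g_def\<close>)
    also have "\<dots> = (\<Sum>t\<in>{..<N} \<inter> {..<T}. \<bar>g t\<bar>) + real N * e"
      by (simp add: sum.distrib sum.inter_restrict)
    also have "(\<Sum>t\<in>{..<N} \<inter> {..<T}. \<bar>g t\<bar>) \<le> K" unfolding K_def by (rule sum_mono2) auto
    finally show ?thesis by simp
  qed
  have "\<bar>1 / real N * (\<Sum>n<N. f ((shift ^^ n) z)) - b\<bar> \<le> e + K / real N" if "N \<ge> 1" for N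
  proof -
    have "1 / real N * (\<Sum>n<N. f ((shift ^^ n) z)) - b = (\<Sum>t<N. g t) / real N"
      using that by (simp add: g_def sum_subtractf diff_divide_distrib)
    also have "\<bar>\<dots>\<bar> \<le> (K + real N * e) / real N"
      using sum[of N] that by (simp add: abs_divide divide_right_mono)
    also have "\<dots> = e + K / real N" using that by (simp add: field_simps)
    finally show ?thesis .
  qed
  moreover have "(\<lambda>N. \<bar>1 / real N * (\<Sum>n<N. f ((shift ^^ n) z)) - b\<bar>) \<longlonglongrightarrow> \<bar>(\<integral>y. f y \<partial>\<nu>) - b\<bar>"
    by (intro tendsto_intros lim)
  moreover have "(\<lambda>N. e + K / real N) \<longlonglongrightarrow> e + 0"
    by (intro tendsto_intros lim_const_over_n)
  ultimately show ?thesis by (intro LIMSEQ_le[of _ _ _ e]) (auto intro!: exI[of _ 1])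
qed

text \<open>The occurrences in the window at \<open>t\<close> are a difference of two partial sums
  from the origin, each off its expected value by a small multiple of its length. As
  \<open>t\<close> is at most a fixed multiple of \<open>n\<close>, this error is small even
  relative to \<open>n\<close>.\<close>

lemma generic_point_windows:
  fixes z :: "int \<Rightarrow> 'a::discrete_topology"
  assumes gen: "generic_point X \<nu> z" and inv: "invariant_measure X \<nu>"
    and u: "length u \<le> l" and e: "0 < e" and K: "0 \<le> K"
  shows "eventually (\<lambda>n. \<forall>t. 0 \<le> t \<and> real_of_int t \<le> K * real n \<longrightarrow>
           \<bar>freq l u (window z t n) - mass \<nu> u\<bar> < e) sequentially"
proof -
  define a where "a = mass \<nu> u"
  define g :: "nat \<Rightarrow> real" where "g t = indicator (cylinder (int t) u) z" for t
  define S where "S N = (\<Sum>t<N. g t)" for N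
  \<comment> \<open>The two partial sums have total length at most \<open>(2 * K + 1) * n\<close>,
    so this tolerance leaves a relative error of \<open>e / 2\<close>.\<close>
  define e' where "e' = e / (2 * (2 * K + 1))"
  note D = invariant_measureD[OF inv]
  interpret prob_space \<nu> by (rule D(1))
  have e': "0 < e'" using e K by (simp add: e'_def)
  have a: "0 \<le> a" "a \<le> 1" by (auto simp: a_def mass_def)
  have "continuous_on X (\<lambda>y. of_bool (window y 0 (length u) = u) :: real)"
    by (rule continuous_on_window)
  then have "continuous_on X (indicator (cylinder 0 u) :: _ \<Rightarrow> real)"
    by (simp add: cylinder_def indicator_def of_bool_def)
  then have "(\<lambda>N. 1 / real N * (\<Sum>n<N. indicator (cylinder 0 u) ((shift ^^ n) z)))
      \<longlonglongrightarrow> (\<integral>y. indicator (cylinder 0 u) y \<partial>\<nu>)"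
    using gen unfolding generic_point_def by blast
  moreover have "indicator (cylinder 0 u) ((shift ^^ n) z) = g n" for n
    by (simp add: g_def indicator_def cylinder_def window_shift_funpow)
  ultimately have lim: "(\<lambda>N. S N / real N) \<longlonglongrightarrow> a" by (simp add: S_def a_def mass_def)
  obtain N0 where N0: "\<bar>S N / real N - a\<bar> < e'" if "N \<ge> N0" for N
    using LIMSEQ_D[OF lim e'] by auto
  have g01: "0 \<le> g t" "g t \<le> 1" for t by (auto simp: g_def indicator_def)
  \<comment> \<open>Short sums, about which the limit says nothing, are off by at most their length;
    this is the constant \<open>N0\<close>.\<close>
  have S: "\<bar>S N - real N * a\<bar> \<le> e' * real N + real N0" for N
  proof (cases "N \<ge> N0 \<and> N > 0")
    case True
    have "\<bar>S N - real N * a\<bar> = real N * \<bar>S N / real N - a\<bar>"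
      using True by (subst abs_of_nonneg[of "real N", symmetric]) (auto simp: abs_mult[symmetric] field_simps)
    also have "\<dots> \<le> real N * e'" using N0 True by (intro mult_left_mono) (auto intro: less_imp_le)
    finally show ?thesis by (simp add: mult.commute)
  next
    case False
    have "0 \<le> S N" "S N \<le> real N"
      using sum_mono[of "{..<N}" g "\<lambda>_. 1"] g01 by (auto simp: S_def intro: sum_nonneg)
    moreover have "0 \<le> real N * a" "real N * a \<le> real N" using a by (auto intro: mult_left_le)
    ultimately have "\<bar>S N - real N * a\<bar> \<le> real N" by linarith
    also have "real N \<le> real N0" using False by auto
    finally show ?thesis using e' by (simp add: add_increasing)
  qed
  have "(\<lambda>n. (2 * real N0 + real l) / real n) \<longlonglongrightarrow> 0" by (rule lim_const_over_n)
  then have "eventually (\<lambda>n. (2 * real N0 + real l) / real n < e / 2) sequentially"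
    by (rule order_tendstoD(2)) (use e in simp)
  then show ?thesis
    using eventually_ge_at_top[of "max 1 l"]
  proof eventually_elim
    fix n assume n: "(2 * real N0 + real l) / real n < e / 2" "max 1 l \<le> n"
    show "\<forall>t. 0 \<le> t \<and> real_of_int t \<le> K * real n \<longrightarrow> \<bar>freq l u (window z t n) - mass \<nu> u\<bar> < e"
    proof (intro allI impI)
      fix t assume t: "0 \<le> t \<and> real_of_int t \<le> K * real n"
      define s where "s = nat t"
      define m where "m = n - l"
      have s: "t = int s" "real s \<le> K * real n" using t by (auto simp: s_def)
      have m: "real m = real n - real l" using n by (simp add: m_def of_nat_diff)
      have "(\<Sum>j<m. indicator (cylinder (t + int j) u) z) = (\<Sum>j<m. g (s + j))"
        by (simp add: g_def s)
      also have "\<dots> = S (s + m) - S s"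
      proof -
        have "S (s + m) = S s + (\<Sum>j=s..<s + m. g j)"
          using sum.atLeastLessThan_concat[of 0 s "s + m" g] by (simp add: S_def lessThan_atLeast0)
        also have "(\<Sum>j=s..<s + m. g j) = (\<Sum>j<m. g (s + j))"
          using sum.shift_bounds_nat_ivl[of g 0 s m] by (simp add: lessThan_atLeast0 add.commute)
        finally show ?thesis by simp
      qed
      finally have freq: "freq l u (window z t n) = (S (s + m) - S s) / real n"
        by (simp add: freq_window[OF u] m_def)
      have "\<bar>S (s + m) - S s - real n * a\<bar> \<le> e' * (2 * real s + real m) + 2 * real N0 + real l"
      proof -
        \<comment> \<open>Only \<open>n - l\<close> positions are inspected, which costs at most
          \<open>l\<close>.\<close>
        have "S (s + m) - S s - real n * a =
          (S (s + m) - real (s + m) * a) - (S s - real s * a) - real l * a"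
          by (simp add: m algebra_simps)
        moreover have "0 \<le> real l * a" "real l * a \<le> real l" using a by (auto intro: mult_left_le)
        ultimately show ?thesis using S[of "s + m"] S[of s] by (simp add: algebra_simps)
      qed
      also have "\<dots> \<le> e' * ((2 * K + 1) * real n) + 2 * real N0 + real l"
        using s(2) m e' by (intro add_right_mono mult_left_mono) (auto simp: algebra_simps)
      also have "e' * (2 * K + 1) = e / 2"
        using K unfolding e'_def by (subst times_divide_eq_left) (simp add: divide_simps)
      then have "e' * ((2 * K + 1) * real n) = e / 2 * real n" by (metis mult.assoc)
      finally have *: "\<bar>S (s + m) - S s - real n * a\<bar> \<le> e / 2 * real n + (2 * real N0 + real l)" by simp
      have "\<bar>freq l u (window z t n) - a\<bar> = \<bar>S (s + m) - S s - real n * a\<bar> / real n"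
        using n(2) by (simp add: freq field_simps abs_divide)
      also have "\<dots> \<le> (e / 2 * real n + (2 * real N0 + real l)) / real n"
        using * by (rule divide_right_mono) simp
      also have "\<dots> = e / 2 + (2 * real N0 + real l) / real n" using n(2) by (simp add: add_divide_distrib)
      also have "\<dots> < e" using n(1) by linarith
      finally show "\<bar>freq l u (window z t n) - mass \<nu> u\<bar> < e" by (simp add: a_def)
    qed
  qed
qed

lemma mass_bounds: "invariant_measure X \<nu> \<Longrightarrow> 0 \<le> mass \<nu> u \<and> mass \<nu> u \<le> 1"
  using prob_space.prob_le_1[OF invariant_measureD(1)] by (simp add: mass_def)

lemma indicator_cylinder_shift:
  "indicator (cylinder 0 u) ((shift ^^ t) y) = (indicator (cylinder (int t) u) y :: real)"
  by (simp add: indicator_def cylinder_def window_shift_funpow)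

lemma continuous_on_indicator_cylinder:
  "continuous_on S (indicator (cylinder t u) :: (int \<Rightarrow> 'a::discrete_topology) \<Rightarrow> real)"
proof -
  have "continuous_on S (\<lambda>y :: int \<Rightarrow> 'a. of_bool (window y t (length u) = u) :: real)"
    by (rule continuous_on_window)
  then show ?thesis by (simp add: cylinder_def indicator_def of_bool_def)
qed

text \<open>The forward orbit of an eventually periodic point approaches a finite cycle, on which
  \<open>\<nu>\<close> would be concentrated, so that some point of the cycle would be an
  atom.\<close>

lemma nonatomic_generic_not_eventually_periodic:
  fixes z :: "int \<Rightarrow> 'a::discrete_topology"
  assumes inv: "invariant_measure X \<nu>" and gen: "generic_point X \<nu> z" and na: "nonatomic \<nu>"
  shows "\<not> eventually_periodic z"
proof
  assume "eventually_periodic z"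
  then obtain p T where p: "0 < p" and per: "\<And>t. T \<le> t \<Longrightarrow> z (t + p) = z t"
    by (auto simp: eventually_periodic_def)
  note D = invariant_measureD[OF inv]
  interpret prob_space \<nu> by (rule D(1))
  define T0 where "T0 = nat T"
  define m where "m = nat p"
  \<comment> \<open>The two-sided periodic point that continues the periodic part of
    \<open>z\<close>, indexed from \<open>T0\<close>; the \<open>c j\<close> are the points of its
    cycle.\<close>
  define y where "y i = z (int T0 + i mod p)" for i
  define c where "c j = (\<lambda>i. y (i + int j))" for j
  define F where "F r = (\<Union>j<m. centered_box r (c j))" for r
  have T0: "T \<le> int T0" by (simp add: T0_def)
  have zy: "z (int T0 + i) = y i" if "0 \<le> i" for i
  proof -
    have "T \<le> int T0 + i mod p" using T0 p by (simp add: add_increasing2)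
    then have "z (int T0 + i mod p + p * int (nat (i div p))) = z (int T0 + i mod p)"
      using periodic_multiple[of T z p _ "nat (i div p)", OF per] p by simp
    moreover have "int (nat (i div p)) = i div p"
      using that p by (simp add: pos_imp_zdiv_nonneg_iff)
    then have "int T0 + i mod p + p * int (nat (i div p)) = int T0 + i" by (simp add: add.assoc)
    ultimately show ?thesis unfolding y_def by metis
  qed
  \<comment> \<open>A box of radius \<open>r\<close> also looks \<open>r\<close> positions back, so
    it sees only the periodic part from time \<open>T0 + r\<close> on.\<close>
  have inF: "(shift ^^ t) z \<in> F r" if t: "T0 + r \<le> t" for t r
  proof -
    define j where "j = (t - T0) mod m"
    have "j < m" using p by (simp add: j_def m_def)
    moreover have "(shift ^^ t) z \<in> centered_box r (c j)"
      unfolding centered_box_def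
    proof safe
      fix i assume i: "i \<in> {- int r..int r}"
      have "(shift ^^ t) z i = z (int T0 + (i + int (t - T0)))"
        using t by (simp add: shift_funpow of_nat_diff)
      also have "\<dots> = y (i + int (t - T0))" using t i by (intro zy) simp
      also have "\<dots> = c j i"
        using p by (simp add: c_def y_def j_def m_def of_nat_mod mod_add_right_eq)
      finally show "(shift ^^ t) z i = c j i" .
    qed
    ultimately show ?thesis by (auto simp: F_def)
  qed
  \<comment> \<open>So \<open>\<nu>\<close> is concentrated on the periodic orbit of \<open>y\<close>.\<close>
  have one: "measure \<nu> (F r \<inter> X) = 1" for r
  proof -
    have "continuous_on X (indicator (F r) :: _ \<Rightarrow> real)"
    proof (rule continuous_on_finite_coordinates[of "{- int r..int r}"])
      fix w w' :: "int \<Rightarrow> 'a" assume "\<And>i. i \<in> {- int r..int r} \<Longrightarrow> w i = w' i"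
      then have "w \<in> F r \<longleftrightarrow> w' \<in> F r" by (simp add: F_def centered_box_def)
      then show "indicator (F r) w = (indicator (F r) w' :: real)" by (simp add: indicator_def)
    qed simp
    from generic_point_tail[OF gen this, of "T0 + r" 1 0] inF
    have "(\<integral>y. indicator (F r) y \<partial>\<nu>) = (1::real)"
      using prob_le_1[of "F r \<inter> space \<nu>"] by simp
    then show ?thesis by (simp add: D(2))
  qed
  \<comment> \<open>Nonatomicity concerns only points of \<open>X\<close>; if \<open>c j\<close>
    lies outside, the boxes shrink to the empty set inside \<open>X\<close>.\<close>
  have lim: "(\<lambda>r. measure \<nu> (centered_box r (c j) \<inter> X)) \<longlonglongrightarrow> 0" for j
  proof -
    have "(\<Inter>r. centered_box r (c j) \<inter> X) = {c j} \<inter> X"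
    proof safe
      fix w assume w: "w \<in> (\<Inter>r. centered_box r (c j) \<inter> X)"
      have "w i = c j i" for i
      proof -
        have "w \<in> centered_box (nat \<bar>i\<bar>) (c j)" using w by blast
        then have "\<forall>k\<in>{- \<bar>i\<bar>..\<bar>i\<bar>}. w k = c j k" by (simp add: centered_box_def)
        then show ?thesis by (rule bspec) auto
      qed
      then show "w = c j" by blast
    qed (auto simp: centered_box_def)
    moreover have "measure \<nu> ({c j} \<inter> X) = 0"
      using na by (cases "c j \<in> X") (auto simp: nonatomic_def D(2) measure_def)
    moreover have "(\<lambda>r. measure \<nu> (centered_box r (c j) \<inter> X)) \<longlonglongrightarrow> measure \<nu> (\<Inter>r. centered_box r (c j) \<inter> X)"
    proof (rule finite_Lim_measure_decseq)
      show "decseq (\<lambda>r. centered_box r (c j) \<inter> X)"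
        by (rule decseq_SucI) (auto simp: centered_box_def)
    qed (use D(3)[OF open_centered_box] in auto)
    ultimately show ?thesis by simp
  qed
  have "1 \<le> (\<Sum>j<m. measure \<nu> (centered_box r (c j) \<inter> X))" for r
  proof -
    have "F r \<inter> X = (\<Union>j<m. centered_box r (c j) \<inter> X)" by (auto simp: F_def)
    then have "1 = measure \<nu> (\<Union>j<m. centered_box r (c j) \<inter> X)" using one[of r] by simp
    also have "\<dots> \<le> (\<Sum>j<m. measure \<nu> (centered_box r (c j) \<inter> X))"
      by (rule finite_measure_subadditive_finite) (use D(3)[OF open_centered_box] in auto)
    finally show ?thesis .
  qed
  moreover have "(\<lambda>r. \<Sum>j<m. measure \<nu> (centered_box r (c j) \<inter> X)) \<longlonglongrightarrow> (\<Sum>j<m. 0)"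
    by (intro tendsto_sum lim)
  ultimately have "(1::real) \<le> (\<Sum>j<m. 0)" by (intro LIMSEQ_le_const) auto
  then show False by simp
qed

section \<open>Orbit closures\<close>

lemma subshift_translate:
  assumes "subshift A X" "x \<in> X"
  shows "(\<lambda>n. x (n + j)) \<in> X"
proof (induction j rule: int_induct[of _ 0])
  case (step1 i)
  then have "shift (\<lambda>n. x (n + i)) \<in> X" using assms(1) by (auto simp: subshift_def)
  then show ?case by (simp add: shift_def algebra_simps)
next
  case (step2 i)
  then have "(\<lambda>n. x (n + i)) \<in> shift ` X" using assms(1) by (simp add: subshift_def)
  then obtain w where w: "w \<in> X" "(\<lambda>n. x (n + i)) = shift w" by auto
  have "x (n + (i - 1)) = w n" for n
    using fun_cong[OF w(2), of "n - 1"] by (simp add: shift_def algebra_simps)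
  then have "(\<lambda>n. x (n + (i - 1))) = w" by auto
  with w show ?case by simp
qed (use assms in simp)

lemma closed_subshift:
  fixes X :: "(int \<Rightarrow> 'a::discrete_topology) set"
  assumes "subshift A X"
  shows "closed X"
proof -
  have "UNIV \<rightarrow> A = (\<Inter>i. - {y :: int \<Rightarrow> 'a. \<forall>k\<in>{i}. y k \<in> - A})" by auto
  moreover have "open {y :: int \<Rightarrow> 'a. \<forall>k\<in>{i}. y k \<in> - A}" for i
    by (rule product_topology_basis'[where x = "\<lambda>i. i"]) (auto intro: open_discrete)
  then have "closed (\<Inter>i. - {y :: int \<Rightarrow> 'a. \<forall>k\<in>{i}. y k \<in> - A})"
    by (intro closed_INT ballI closed_Compl)
  ultimately have "closed (UNIV \<rightarrow> A :: (int \<Rightarrow> 'a) set)" by metis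
  then show ?thesis using assms closedin_closed_trans by (auto simp: subshift_def)
qed

text \<open>Cylinders are open, so one that contains a point of the closure already meets the
  orbit.\<close>

lemma window_orbit_closure:
  assumes "y \<in> closure (shift_orbit x)"
  obtains c where "window y t n = window (x :: int \<Rightarrow> 'a::discrete_topology) c n"
proof -
  have "cylinder t (window y t n) \<inter> closure (shift_orbit x) \<noteq> {}"
    using assms by (auto simp: cylinder_def)
  then have "cylinder t (window y t n) \<inter> shift_orbit x \<noteq> {}"
    using open_Int_closure_eq_empty[OF open_cylinder] by blast
  then obtain j where "window (\<lambda>i. x (i + j)) t n = window y t n"
    by (auto simp: cylinder_def shift_orbit_def)
  moreover have "window (\<lambda>i. x (i + j)) t n = window x (t + j) n"
    by (simp add: window_def algebra_simps)
  ultimately show thesis using that by metis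
qed

text \<open>The complement is a countable union of boxes whose words never occur in
  \<open>x\<close>; by genericity these words have mass zero.\<close>

lemma orbit_closure_conull:
  assumes X: "subshift A X" "\<And>n. finite (words X n)"
    and inv: "invariant_measure X \<mu>" and gen: "generic_point X \<mu> x"
  shows "X - closure (shift_orbit x) \<in> null_sets \<mu>"
proof -
  let ?Y = "closure (shift_orbit x)"
  note D = invariant_measureD[OF inv]
  interpret prob_space \<mu> by (rule D(1))
  have "B \<in> null_sets \<mu>" if B: "B \<in> boxes X" "B \<subseteq> - ?Y" for B
  proof (cases "B = {}")
    case False
    then obtain p y where y: "B = centered_box p y \<inter> X" using B(1) by (auto simp: boxes_def)
    define u where "u = window y (- int p) (2 * p + 1)"
    have never: "window x t (length u) \<noteq> u" for t
    proof
      assume *: "window x t (length u) = u"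
      have "window (\<lambda>i. x (i + (t + int p))) (- int p) (2 * p + 1) = window x t (2 * p + 1)"
        by (simp add: window_def algebra_simps)
      then have "(\<lambda>i. x (i + (t + int p))) \<in> centered_box p y"
        using * by (simp add: centered_box_eq_cylinder cylinder_def u_def)
      moreover have "(\<lambda>i. x (i + (t + int p))) \<in> X"
        using subshift_translate[OF X(1)] gen by (simp add: generic_point_def)
      moreover have "(\<lambda>i. x (i + (t + int p))) \<in> ?Y"
        using closure_subset[of "shift_orbit x"] by (auto simp: shift_orbit_def)
      ultimately show False using B(2) y by auto
    qed
    have notin: "x \<notin> cylinder t u" for t using never by (simp add: cylinder_def)
    have "\<bar>(\<integral>y. indicator (cylinder 0 u) y \<partial>\<mu>) - 0 :: real\<bar> \<le> 0"
      by (rule generic_point_tail[OF gen continuous_on_indicator_cylinder])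
         (simp add: indicator_cylinder_shift notin)
    then have "mass \<mu> u = 0"
      using measure_nonneg[of \<mu> "cylinder 0 u \<inter> space \<mu>"] by (simp add: mass_def)
    then have "emeasure \<mu> B = 0"
      using measure_cylinder[OF inv, of "- int p" u]
      by (simp add: emeasure_eq_measure y centered_box_eq_cylinder u_def)
    then show ?thesis using y D(3)[OF open_centered_box] by auto
  qed simp
  then have "(\<Union>B\<in>{B \<in> boxes X. B \<subseteq> - ?Y}. B) \<in> null_sets \<mu>"
    by (intro null_sets_UN') (auto intro: countable_subset[OF _ countable_boxes[OF X(2)]])
  moreover have "X - ?Y = (\<Union>B\<in>{B \<in> boxes X. B \<subseteq> - ?Y}. B)"
    using open_Int_eq_Union_boxes[of "- ?Y" X] by (auto simp: open_Compl)
  ultimately show ?thesis by simp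
qed

lemma shift_orbit_closure:
  fixes x :: "int \<Rightarrow> 'a::discrete_topology"
  shows "y \<in> closure (shift_orbit x) \<Longrightarrow> shift y \<in> closure (shift_orbit x)"
proof -
  have "continuous_on UNIV (shift :: (int \<Rightarrow> 'a) \<Rightarrow> _)"
    unfolding shift_def by (intro continuous_on_coordinatewise_then_product) simp
  then have "continuous_on (closure (shift_orbit x)) shift" by (rule continuous_on_subset) simp
  moreover have "shift ` shift_orbit x \<subseteq> closure (shift_orbit x)"
  proof -
    have "shift (\<lambda>n. x (n + j)) = (\<lambda>n. x (n + (j + 1)))" for j
      by (simp add: shift_def algebra_simps)
    then show ?thesis using closure_subset[of "shift_orbit x"] by (auto simp: shift_orbit_def)
  qed
  ultimately have "shift ` closure (shift_orbit x) \<subseteq> closure (shift_orbit x)"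
    by (intro image_closure_subset) auto
  then show "y \<in> closure (shift_orbit x) \<Longrightarrow> shift y \<in> closure (shift_orbit x)" by auto
qed

text \<open>The orbit closure has full measure, so \<open>\<mu>\<close> restricts to an invariant
  measure there. This supplies the existence half of unique ergodicity, whose failure must then mean
  a second measure.\<close>

lemma generic_measure_orbit_closure:
  assumes X: "subshift A X" "\<And>n. finite (words X n)"
    and inv: "invariant_measure X \<mu>" and gen: "generic_point X \<mu> x"
  defines "Y \<equiv> closure (shift_orbit x)"
  shows "Y \<subseteq> X" "invariant_measure Y (restrict_space \<mu> Y)" "mass (restrict_space \<mu> Y) u = mass \<mu> u"
proof -
  note D = invariant_measureD[OF inv]
  interpret prob_space \<mu> by (rule D(1))
  have "x \<in> X" using gen by (simp add: generic_point_def)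
  then have "shift_orbit x \<subseteq> X" using subshift_translate[OF X(1)] by (auto simp: shift_orbit_def)
  then show YX: "Y \<subseteq> X" unfolding Y_def using closed_subshift[OF X(1)] by (rule closure_minimal)
  have Ysets: "Y \<in> sets \<mu>"
    unfolding D(4) sets_restrict_space using YX by (auto intro!: image_eqI[of _ _ Y] simp: Y_def)
  have AE: "AE w in \<mu>. w \<in> Y"
    using AE_not_in[OF orbit_closure_conull[OF X inv gen]] AE_space
    by eventually_elim (auto simp: D(2) Y_def)
  have emY: "emeasure \<mu> (B \<inter> Y) = emeasure \<mu> B" if "B \<in> sets \<mu>" for B
    by (rule emeasure_eq_AE) (use AE that Ysets in auto)
  have sp: "space (restrict_space \<mu> Y) = Y" using YX by (auto simp: space_restrict_space D(2))
  have em: "emeasure (restrict_space \<mu> Y) B = emeasure \<mu> B" if "B \<subseteq> Y" for B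
    by (rule emeasure_restrict_space) (use that Ysets in auto)
  have "space \<mu> \<inter> Y = Y" using YX D(2) by auto
  then have "emeasure \<mu> Y = 1" using emY[OF sets.top] emeasure_space_1 by simp
  then have prob: "prob_space (restrict_space \<mu> Y)"
    by (intro prob_spaceI) (simp add: sp em)
  have sets: "sets (restrict_space \<mu> Y) = sets (restrict_space borel Y)"
  proof -
    have "Y \<inter> (X \<inter> B) = Y \<inter> B" for B using YX by auto
    then show ?thesis by (simp add: sets_restrict_space D(4) image_image)
  qed
  have shift: "shift \<in> measurable (restrict_space \<mu> Y) (restrict_space \<mu> Y)"
    by (intro measurable_restrict_space2 measurable_restrict_space1 D(5))
       (use shift_orbit_closure[of _ x, folded Y_def] in \<open>auto simp: sp\<close>)
  have "distr (restrict_space \<mu> Y) (restrict_space \<mu> Y) shift = restrict_space \<mu> Y"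
  proof (rule measure_eqI)
    fix B assume "B \<in> sets (distr (restrict_space \<mu> Y) (restrict_space \<mu> Y) shift)"
    then have B: "B \<in> sets (restrict_space \<mu> Y)" by simp
    then have B': "B \<in> sets \<mu>" "B \<subseteq> Y"
      using Ysets sets.sets_into_space[OF B] by (auto simp: sets_restrict_space sp)
    have "emeasure (distr (restrict_space \<mu> Y) (restrict_space \<mu> Y) shift) B
        = emeasure \<mu> (shift -` B \<inter> Y)"
      using B shift by (simp add: emeasure_distr sp em)
    also have "\<dots> = emeasure \<mu> ((shift -` B \<inter> X) \<inter> Y)" using YX by (simp add: Int_assoc Int_absorb1)
    also have "\<dots> = emeasure \<mu> (shift -` B \<inter> X)"
      by (rule emY) (use measurable_sets[OF D(5) B'(1)] in \<open>simp add: D(2)\<close>)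
    also have "\<dots> = emeasure (distr \<mu> \<mu> shift) B" using B'(1) D(5) by (simp add: emeasure_distr D(2))
    also have "\<dots> = emeasure (restrict_space \<mu> Y) B" using em[OF B'(2)] by (simp add: D(6))
    finally show "emeasure (distr (restrict_space \<mu> Y) (restrict_space \<mu> Y) shift) B
        = emeasure (restrict_space \<mu> Y) B" .
  qed simp
  with prob sets shift show "invariant_measure Y (restrict_space \<mu> Y)"
    by (simp add: invariant_measure_def)
  have "emeasure (restrict_space \<mu> Y) (cylinder 0 u \<inter> Y) = emeasure \<mu> ((cylinder 0 u \<inter> X) \<inter> Y)"
    using YX by (simp add: em Int_assoc Int_absorb1)
  also have "\<dots> = emeasure \<mu> (cylinder 0 u \<inter> X)" by (rule emY) (rule D(3)[OF open_cylinder])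
  finally show "mass (restrict_space \<mu> Y) u = mass \<mu> u" by (simp add: mass_def sp D(2) measure_def)
qed

lemma not_uniquely_ergodic_orbit_closure:
  assumes X: "subshift A X" "\<And>n. finite (words X n)"
    and inv: "invariant_measure X \<mu>" and gen: "generic_point X \<mu> x"
    and nue: "\<not> uniquely_ergodic (closure (shift_orbit x))"
  obtains \<nu> u where "invariant_measure (closure (shift_orbit x)) \<nu>" "mass \<nu> u \<noteq> mass \<mu> u"
proof -
  let ?Y = "closure (shift_orbit x)"
  note G = generic_measure_orbit_closure[OF X inv gen]
  obtain \<nu> where \<nu>: "invariant_measure ?Y \<nu>" "\<nu> \<noteq> restrict_space \<mu> ?Y"
    using nue G(2) unfolding uniquely_ergodic_def by blast
  have fin: "finite (words ?Y n)" for n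
    by (rule finite_subset[OF _ X(2)[of n]]) (use G(1) in \<open>auto simp: words_def\<close>)
  have "\<exists>u. mass \<nu> u \<noteq> mass (restrict_space \<mu> ?Y) u"
    using invariant_measure_eqI[OF fin \<nu>(1) G(2)] \<nu>(2) by blast
  then show thesis using that[OF \<nu>(1)] G(3) by metis
qed

text \<open>Every window of a point of the closure is a window of \<open>x\<close>, so a bound on
  frequencies in \<open>x\<close> holds for all these points and may be integrated.\<close>

lemma orbit_closure_freq_bound:
  assumes inv: "invariant_measure (closure (shift_orbit x)) \<nu>" and u: "length u \<le> l"
    and bound: "\<And>c. \<bar>freq l u (window x c n) - b\<bar> \<le> e"
  shows "\<bar>real (n - l) / real n * mass \<nu> u - b\<bar> \<le> e"
proof -
  note D = invariant_measureD[OF inv]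
  interpret prob_space \<nu> by (rule D(1))
  have *: "\<bar>freq l u (window y 0 n) - b\<bar> \<le> e" if "y \<in> closure (shift_orbit x)" for y
    using window_orbit_closure[OF that, of 0 n] bound by metis
  have "(\<integral>y. freq l u (window y 0 n) \<partial>\<nu>) \<le> b + e"
    by (rule integral_le_const[OF integrable_freq[OF inv u]]) (use * in \<open>force simp: D(2) abs_le_iff\<close>)
  moreover have "b - e \<le> (\<integral>y. freq l u (window y 0 n) \<partial>\<nu>)"
    by (rule integral_ge_const[OF integrable_freq[OF inv u]]) (use * in \<open>force simp: D(2) abs_le_iff\<close>)
  ultimately show ?thesis unfolding integral_freq[OF inv u] by linarith
qed

text \<open>Here genericity turns a bound along the orbit of \<open>z\<close> into one on the
  integral, and any initial stretch may be disregarded.\<close>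

lemma generic_point_freq_bound:
  assumes inv: "invariant_measure X \<nu>" and gen: "generic_point X \<nu> z" and u: "length u \<le> l"
    and bound: "\<And>t. T \<le> t \<Longrightarrow> \<bar>freq l u (window z t n) - b\<bar> \<le> e"
  shows "\<bar>real (n - l) / real n * mass \<nu> u - b\<bar> \<le> e"
  unfolding integral_freq[OF inv u, of 0 n, symmetric]
  by (rule generic_point_tail[OF gen continuous_on_window, of "nat T"])
     (use bound in \<open>simp add: window_shift_funpow\<close>)

lemma freq_deficit:
  assumes "0 < n" "0 \<le> a \<and> a \<le> (1::real)"
  shows "\<bar>real (n - l) / real n * a - a\<bar> \<le> real l / real n"
proof -
  have q: "real (n - l) / real n \<le> 1" "1 - real l / real n \<le> real (n - l) / real n"
  proof -
    show "real (n - l) / real n \<le> 1" using assms(1) by simp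
    have "real n - real l \<le> real (n - l)" by linarith
    then have "(real n - real l) / real n \<le> real (n - l) / real n" by (rule divide_right_mono) simp
    then show "1 - real l / real n \<le> real (n - l) / real n" using assms(1) by (simp add: diff_divide_distrib)
  qed
  have "\<bar>real (n - l) / real n * a - a\<bar> = (1 - real (n - l) / real n) * a"
    using q(1) assms(2) mult_left_le_one_le[of a "real (n - l) / real n"] by (simp add: algebra_simps)
  also have "\<dots> \<le> 1 - real (n - l) / real n" using q(1) assms(2) by (intro mult_left_le) auto
  finally show ?thesis using q(2) by linarith
qed

section \<open>Choice of scales\<close>

text \<open>Growth by at least \<open>k\<close> at every step from about \<open>\<delta> * L\<close>
  to \<open>L\<close> would make \<open>P L\<close> nearly \<open>k * (1 - \<delta>) * L\<close> or
  more, which exceeds \<open>r * L\<close> when \<open>\<delta>\<close> is small and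
  \<open>L\<close> large.\<close>

lemma slow_growth_scales:
  fixes P :: "nat \<Rightarrow> nat" and r :: real
  assumes r: "0 \<le> r" "r < real k" and P: "\<And>n. N \<le> n \<Longrightarrow> real (P n) \<le> r * real n"
  obtains \<delta> L0 where "0 < \<delta>"
    "\<And>L. L0 \<le> L \<Longrightarrow> \<exists>n. \<delta> * real L \<le> real n \<and> n \<le> L \<and> P (Suc n) < P n + k"
proof -
  \<comment> \<open>This makes \<open>k * (1 - \<delta>)\<close> the midpoint of \<open>r\<close>
    and \<open>k\<close>. The surplus \<open>(k - r) / 2 * L\<close> outweighs the loss
    \<open>k\<close> from rounding \<open>\<delta> * L\<close> up as soon as
    \<open>L > 2 * k / (k - r)\<close>.\<close>
  define \<delta> where "\<delta> = (real k - r) / (2 * real k)"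
  have k: "0 < real k" using r by linarith
  have \<delta>: "0 < \<delta>" "\<delta> \<le> 1" using r k by (auto simp: \<delta>_def field_simps)
  have k\<delta>: "real k * \<delta> = (real k - r) / 2" using k by (simp add: \<delta>_def)
  define L0 where "L0 = max N (nat \<lceil>2 * real k / (real k - r)\<rceil> + 1)"
  have "\<exists>n. \<delta> * real L \<le> real n \<and> n \<le> L \<and> P (Suc n) < P n + k" if L: "L0 \<le> L" for L
  proof (rule ccontr)
    assume no: "\<not> ?thesis"
    define a where "a = nat \<lceil>\<delta> * real L\<rceil>"
    have "\<delta> * real L \<le> real L" using \<delta> by (intro mult_left_le_one_le) auto
    then have a: "\<delta> * real L \<le> real a" "real a \<le> \<delta> * real L + 1" "a \<le> L"
      using \<delta>(1) by (auto simp: a_def ceiling_le_iff nat_le_iff)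
    have "real k * real j \<le> real (P (a + j))" if "a + j \<le> L" for j
      using that
    proof (induction j)
      case (Suc j)
      have "\<delta> * real L \<le> real (a + j)" using a(1) by simp
      then have "P (a + j) + k \<le> P (Suc (a + j))" using no Suc(2) by (simp add: not_less)
      then have "real (P (a + j)) + real k \<le> real (P (a + Suc j))"
        by (metis add_Suc_right of_nat_add of_nat_le_iff)
      with Suc show ?case by (simp add: algebra_simps)
    qed simp
    from this[of "L - a"] a(3) have "real k * (real L - real a) \<le> real (P L)" by (simp add: of_nat_diff)
    also have "\<dots> \<le> r * real L" using P L by (simp add: L0_def)
    finally have 1: "real k * (real L - real a) \<le> r * real L" .
    have "real k * real a \<le> real k * (\<delta> * real L + 1)" using a(2) k by (intro mult_left_mono) auto
    also have "\<dots> = (real k * \<delta>) * real L + real k" by (simp add: algebra_simps)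
    also have "\<dots> = (real k - r) * real L / 2 + real k" by (simp add: k\<delta>)
    finally have "real k * real a \<le> (real k - r) * real L / 2 + real k" .
    moreover have "(real k - r) * real L \<le> real k * real a" using 1 by (simp add: algebra_simps)
    ultimately have "(real k - r) * real L \<le> 2 * real k" by linarith
    then have "real L \<le> 2 * real k / (real k - r)" using r(2) by (simp add: field_simps)
    moreover have "2 * real k / (real k - r) < real L"
    proof -
      have "2 * real k / (real k - r) \<le> real (nat \<lceil>2 * real k / (real k - r)\<rceil>)"
        by (rule real_nat_ceiling_ge)
      also have "\<dots> < real L" using L by (simp add: L0_def)
      finally show ?thesis .
    qed
    ultimately show False by simp
  qed
  with \<delta>(1) show thesis using that by blast
qed

text \<open>One word per pair suffices, and finitely many pairs share a positive gap. The factor 3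
  leaves room for an error in the frequency and one for the discarded positions.\<close>

lemma separating_words:
  assumes "finite R" "\<And>p. p \<in> R \<Longrightarrow> \<exists>u. mass (fst p) u \<noteq> mass (snd p) u"
  shows "\<exists>U e l. finite U \<and> 0 < e \<and> (\<forall>u\<in>U. length u \<le> l) \<and>
    (\<forall>p\<in>R. \<exists>u\<in>U. 3 * e \<le> \<bar>mass (fst p) u - mass (snd p) u\<bar>)"
proof -
  obtain f where f: "\<And>p. p \<in> R \<Longrightarrow> mass (fst p) (f p) \<noteq> mass (snd p) (f p)" using assms(2) by metis
  define d where "d p = \<bar>mass (fst p) (f p) - mass (snd p) (f p)\<bar>" for p
  \<comment> \<open>\<open>insert 1\<close> and, below, \<open>insert 0\<close> keep
    \<open>Min\<close> and \<open>Max\<close> meaningful when \<open>R\<close> is empty.\<close>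
  define e where "e = Min (insert 1 (d ` R)) / 3"
  show ?thesis
  proof (intro exI[of _ "f ` R"] exI[of _ e] exI[of _ "Max (insert 0 (length ` f ` R))"] conjI ballI)
    show "0 < e" using assms(1) f by (auto simp: e_def d_def)
    show "\<exists>u\<in>f ` R. 3 * e \<le> \<bar>mass (fst p) u - mass (snd p) u\<bar>" if "p \<in> R" for p
    proof (intro bexI[of _ "f p"])
      have "Min (insert 1 (d ` R)) \<le> d p" by (rule Min_le) (use assms(1) that in auto)
      then show "3 * e \<le> \<bar>mass (fst p) (f p) - mass (snd p) (f p)\<bar>" by (simp add: e_def d_def)
    qed (use that in simp)
    show "length u \<le> Max (insert 0 (length ` f ` R))" if "u \<in> f ` R" for u
      by (rule Max_ge) (use assms(1) that in auto)
  qed (use assms(1) in simp)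
qed

lemma branching_scale:
  fixes x :: "int \<Rightarrow> 'a" and c :: nat
  assumes x: "x \<in> X" "\<not> eventually_periodic x" and fin: "finite (words X N)"
    and bound: "complexity X N \<le> c * N"
  obtains L where "N \<le> L"
    "\<And>n. n \<le> L \<Longrightarrow> \<exists>s t. 0 \<le> s \<and> 0 \<le> t \<and> s \<le> int ((c + 1) * L) \<and> t \<le> int ((c + 1) * L) \<and>
        window x s n = window x t n \<and> x (s + int n) \<noteq> x (t + int n)"
proof -
  \<comment> \<open>Two occurrences of the same word of length \<open>N\<close> are extended until they first disagree, which
    gives right special words of all lengths up to the length \<open>L\<close> of the common extension.\<close>
  obtain a b where ab: "0 \<le> a" "a < b" "b \<le> 0 + int (complexity X N)" "window x a N = window x b N"
    using window_repeat[OF x(1) fin] .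
  have "\<exists>L. x (a + int L) \<noteq> x (b + int L)"
  proof (rule ccontr)
    assume no: "\<not> ?thesis"
    have "x (t + (b - a)) = x t" if "a \<le> t" for t
      using no[simplified, rule_format, of "nat (t - a)"] that by (simp add: algebra_simps)
    then have "eventually_periodic x"
      unfolding eventually_periodic_def using ab(2) by (intro exI[of _ "b - a"]) auto
    with x(2) show False ..
  qed
  define L where "L = (LEAST L. x (a + int L) \<noteq> x (b + int L))"
  have L: "x (a + int L) \<noteq> x (b + int L)"
    unfolding L_def by (rule LeastI_ex) fact
  have least: "x (a + int i) = x (b + int i)" if "i < L" for i
    using not_less_Least[of i "\<lambda>L. x (a + int L) \<noteq> x (b + int L)"] that by (auto simp: L_def)
  have NL: "N \<le> L"
  proof (rule ccontr)
    assume "\<not> N \<le> L"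
    then have "window x a N ! L = x (a + int L)" "window x b N ! L = x (b + int L)" by simp_all
    with ab(4) L show False by simp
  qed
  show thesis
  proof (rule that[OF NL])
    fix n assume n: "n \<le> L"
    have "b \<le> int (c * L)"
    proof -
      have "complexity X N \<le> c * L" using bound NL by (meson le_trans mult_le_mono2)
      then show ?thesis using ab(3) by linarith
    qed
    then have le: "b + int (L - n) \<le> int ((c + 1) * L)" by simp
    \<comment> \<open>Both windows end just before the first disagreement, at distance
      \<open>L\<close> from \<open>a\<close> and \<open>b\<close>.\<close>
    have "window x (a + int (L - n)) n = window x (b + int (L - n)) n"
    proof (rule nth_equalityI)
      fix i assume "i < length (window x (a + int (L - n)) n)"
      then show "window x (a + int (L - n)) n ! i = window x (b + int (L - n)) n ! i"
        using least[of "L - n + i"] n by (simp add: algebra_simps)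
    qed simp
    moreover have "x (a + int (L - n) + int n) \<noteq> x (b + int (L - n) + int n)"
      using L n by (simp add: of_nat_diff)
    ultimately show "\<exists>s t. 0 \<le> s \<and> 0 \<le> t \<and> s \<le> int ((c + 1) * L) \<and> t \<le> int ((c + 1) * L) \<and>
        window x s n = window x t n \<and> x (s + int n) \<noteq> x (t + int n)"
      using ab(1,2) le by (intro exI[of _ "a + int (L - n)"] exI[of _ "b + int (L - n)"]) auto
  qed
qed

section \<open>Contradiction from \<open>k - 1\<close> measures\<close>

theorem theorem1p2:
  fixes A :: "'a::discrete_topology set" and X :: "(int \<Rightarrow> 'a) set" and k :: nat
    and \<mu> :: "(int \<Rightarrow> 'a) measure" and x :: "int \<Rightarrow> 'a"
  assumes "finite A" and "subshift A X"
    and "limsup (\<lambda>n. ereal (real (complexity X n) / real n)) < ereal (real k)"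
    and "generic_measure X \<mu>" and "generic_point X \<mu> x"
    and "\<not> uniquely_ergodic (closure (shift_orbit x))"
  shows "finite {\<nu>. generic_measure X \<nu> \<and> nonatomic \<nu>} \<and>
         int (card {\<nu>. generic_measure X \<nu> \<and> nonatomic \<nu>}) \<le> int k - 2"
proof (rule ccontr)
  let ?G = "{\<nu>. generic_measure X \<nu> \<and> nonatomic \<nu>}" and ?P = "complexity X"
  assume contra: "\<not> ?thesis"
  note gen = assms(5)
  have inv: "invariant_measure X \<mu>" using assms(4) by (simp add: generic_measure_def)
  have x: "x \<in> X" using gen by (simp add: generic_point_def)
  have "X \<subseteq> UNIV \<rightarrow> A" using assms(2) unfolding subshift_def by (blast dest: closedin_imp_subset)
  then have fin: "finite (words X n)" for n by (rule finite_words) fact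
  obtain q where q: "limsup (\<lambda>n. ereal (real (?P n) / real n)) < ereal q" "ereal q < ereal (real k)"
    using ereal_dense2[OF assms(3)] by auto
  have "eventually (\<lambda>n. ereal (real (?P n) / real n) < ereal q) sequentially"
    using q(1) by (rule Limsup_lessD)
  then have "eventually (\<lambda>n. real (?P n) / real n < q) sequentially" by simp
  then obtain N0 where N0: "\<And>n. N0 \<le> n \<Longrightarrow> real (?P n) / real n < q"
    by (auto simp: eventually_sequentially)
  have "0 \<le> real (?P N0) / real N0" by simp
  also have "\<dots> < q" using N0 by simp
  finally have q0: "0 \<le> q" "q < real k" using q(2) by auto
  then have k: "0 < k" by (cases k) auto
  \<comment> \<open>Length 0 is left out: there the quotient is 0 by convention and bounds
    nothing.\<close>
  define N1 where "N1 = max 1 N0"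
  have Pq: "real (?P n) \<le> q * real n" if "N1 \<le> n" for n
    using N0[of n] that by (auto simp: N1_def pos_divide_less_eq)
  have Pk: "?P n \<le> k * n" if "N1 \<le> n" for n
  proof -
    have "real (?P n) \<le> real k * real n"
      using Pq[OF that] mult_right_mono[of q "real k" "real n"] q0(2) by simp
    then show ?thesis by (simp flip: of_nat_mult)
  qed
  \<comment> \<open>For \<open>k = 1\<close> the set \<open>M\<close> is empty and the claimed bound
    negative; the argument then shows that this case cannot occur.\<close>
  obtain M where M: "M \<subseteq> ?G" "card M = k - 1" "finite M"
  proof (cases "finite ?G")
    case True
    then have "k - 1 \<le> card ?G" using contra by auto
    then show thesis using that by (rule obtain_subset_with_card_n)
  next
    case False
    then show thesis using infinite_arbitrarily_large[OF False, of "k - 1"] that by blast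
  qed
  have M_inv: "invariant_measure X \<nu>" if "\<nu> \<in> insert \<mu> M" for \<nu>
    using that M(1) inv by (auto simp: generic_measure_def)
  \<comment> \<open>The graph argument needs \<open>z \<mu> = x\<close> when \<open>\<mu>\<close> is
    one of the measures in \<open>M\<close>.\<close>
  define z where "z \<nu> = (if \<nu> = \<mu> then x else SOME y. generic_point X \<nu> y)" for \<nu>
  have z_gen: "generic_point X \<nu> (z \<nu>)" if "\<nu> \<in> insert \<mu> M" for \<nu>
  proof (cases "\<nu> = \<mu>")
    case False
    then have "\<exists>y. generic_point X \<nu> y" using that M(1) by (auto simp: generic_measure_def)
    then show ?thesis using False by (simp add: z_def someI_ex)
  qed (use gen in \<open>simp add: z_def\<close>)
  have z_nep: "\<not> eventually_periodic (z \<nu>)" if "\<nu> \<in> M" for \<nu>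
    using nonatomic_generic_not_eventually_periodic[OF M_inv z_gen, of \<nu>] that M(1) by auto
  obtain \<nu>0 u0 where \<nu>0: "invariant_measure (closure (shift_orbit x)) \<nu>0" "mass \<nu>0 u0 \<noteq> mass \<mu> u0"
    using not_uniquely_ergodic_orbit_closure[OF assms(2) fin inv gen assms(6)] .
  \<comment> \<open>\<open>\<nu>0\<close> is kept apart from \<open>\<mu>\<close> to show that
    \<open>x\<close> does not look like \<open>\<mu>\<close> everywhere; the other pairs make
    \<open>L\<close> exclusive and yield \<open>esc\<close>.\<close>
  define R where "R = insert (\<nu>0, \<mu>) {(\<nu>, \<nu>') \<in> insert \<mu> M \<times> insert \<mu> M. \<nu> \<noteq> \<nu>'}"
  have "R \<subseteq> insert (\<nu>0, \<mu>) (insert \<mu> M \<times> insert \<mu> M)" by (auto simp: R_def)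
  then have R_fin: "finite R" by (rule finite_subset) (use M(3) in simp)
  have R_sep: "\<exists>u. mass (fst p) u \<noteq> mass (snd p) u" if "p \<in> R" for p
  proof (cases "p = (\<nu>0, \<mu>)")
    case True
    then show ?thesis using \<nu>0(2) by auto
  next
    case False
    then have "fst p \<in> insert \<mu> M" "snd p \<in> insert \<mu> M" "fst p \<noteq> snd p"
      using that by (auto simp: R_def)
    then show ?thesis using invariant_measure_eqI[OF fin M_inv M_inv] by blast
  qed
  obtain U e l where U: "finite U" "0 < e" "\<And>u. u \<in> U \<Longrightarrow> length u \<le> l"
    "\<And>p. p \<in> R \<Longrightarrow> \<exists>u\<in>U. 3 * e \<le> \<bar>mass (fst p) u - mass (snd p) u\<bar>"
    using separating_words[OF R_fin R_sep] by blast
  define L where "L \<nu> w \<longleftrightarrow> (\<forall>u\<in>U. \<bar>freq l u w - mass \<nu> u\<bar> < e)" for \<nu> w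
  have excl: "\<nu> = \<nu>'" if wL: "\<nu> \<in> insert \<mu> M" "\<nu>' \<in> insert \<mu> M" "L \<nu> w" "L \<nu>' w" for \<nu> \<nu>' w
  proof (rule ccontr)
    assume "\<nu> \<noteq> \<nu>'"
    then obtain u where u: "u \<in> U" "3 * e \<le> \<bar>mass \<nu> u - mass \<nu>' u\<bar>"
      using U(4)[of "(\<nu>, \<nu>')"] wL(1,2) by (auto simp: R_def)
    then have "\<bar>freq l u w - mass \<nu> u\<bar> < e" "\<bar>freq l u w - mass \<nu>' u\<bar> < e"
      using wL(3,4) by (auto simp: L_def)
    with u(2) U(2) show False by linarith
  qed
  obtain \<delta> L0 where \<delta>: "0 < \<delta>"
    and scale: "\<And>S. L0 \<le> S \<Longrightarrow> \<exists>n. \<delta> * real S \<le> real n \<and> n \<le> S \<and> ?P (Suc n) < ?P n + k"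
    using slow_growth_scales[of q k N1 ?P] q0 Pq by metis
  \<comment> \<open>The first term covers the branching positions in \<open>x\<close>, the second
    two stretches of \<open>?P n \<le> k * n\<close>, the last the added constants.\<close>
  define K where "K = (real k + 1) / \<delta> + 2 * real k + 3"
  have K: "0 \<le> K" using \<delta> by (simp add: K_def)
  have "eventually (\<lambda>n. \<forall>\<nu>\<in>insert \<mu> M. \<forall>u\<in>U. \<forall>t. 0 \<le> t \<and> real_of_int t \<le> K * real n \<longrightarrow>
      \<bar>freq l u (window (z \<nu>) t n) - mass \<nu> u\<bar> < e) sequentially"
  proof (intro eventually_ball_finite ballI)
    fix \<nu> u assume "\<nu> \<in> insert \<mu> M" "u \<in> U"
    then show "eventually (\<lambda>n. \<forall>t. 0 \<le> t \<and> real_of_int t \<le> K * real n \<longrightarrow>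
        \<bar>freq l u (window (z \<nu>) t n) - mass \<nu> u\<bar> < e) sequentially"
      using generic_point_windows[OF z_gen M_inv U(3) U(2) K] by blast
  qed (use M(3) U(1) in auto)
  then obtain N2 where N2: "\<And>n \<nu> u t. N2 \<le> n \<Longrightarrow> \<nu> \<in> insert \<mu> M \<Longrightarrow> u \<in> U \<Longrightarrow> 0 \<le> t \<Longrightarrow>
      real_of_int t \<le> K * real n \<Longrightarrow> \<bar>freq l u (window (z \<nu>) t n) - mass \<nu> u\<bar> < e"
    unfolding eventually_sequentially by metis
  have Lz: "L \<nu> (window (z \<nu>) t n)"
    if "N2 \<le> n" "\<nu> \<in> insert \<mu> M" "0 \<le> t" "real_of_int t \<le> K * real n" for n \<nu> t
    using N2 that by (auto simp: L_def)
  have "(\<lambda>n. real l / real n) \<longlonglongrightarrow> 0" by (rule lim_const_over_n)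
  then have "eventually (\<lambda>n. real l / real n < e) sequentially"
    by (rule order_tendstoD(2)) (rule U(2))
  then obtain N3 where N3: "\<And>n. N3 \<le> n \<Longrightarrow> real l / real n < e"
    by (auto simp: eventually_sequentially)
  have not_close: "\<not> \<bar>real (n - l) / real n * mass \<nu> u - mass \<mu> u\<bar> \<le> e"
    if "N3 \<le> n" "0 < n" "3 * e \<le> \<bar>mass \<nu> u - mass \<mu> u\<bar>" "0 \<le> mass \<nu> u \<and> mass \<nu> u \<le> 1" for n \<nu> u
  proof -
    have "\<not> \<bar>a' - b\<bar> \<le> e" if "\<bar>a' - a\<bar> \<le> d" "d < e" "3 * e \<le> \<bar>a - b\<bar>" for a a' b d
      using that by linarith
    then show ?thesis using freq_deficit[OF that(2,4), of l] N3[OF that(1)] that(3) by blast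
  qed
  \<comment> \<open>Otherwise \<open>\<nu>0\<close> would have nearly the masses of
    \<open>\<mu>\<close> on all of \<open>U\<close>.\<close>
  have far: "\<exists>c. \<not> L \<mu> (window x c n)" if n: "N3 \<le> n" "0 < n" for n
  proof (rule ccontr)
    assume no: "\<not> ?thesis"
    obtain u where u: "u \<in> U" "3 * e \<le> \<bar>mass \<nu>0 u - mass \<mu> u\<bar>"
      using U(4)[of "(\<nu>0, \<mu>)"] by (auto simp: R_def)
    have "\<bar>freq l u (window x c n) - mass \<mu> u\<bar> \<le> e" for c
      using no u(1) by (auto simp: L_def intro: less_imp_le)
    from orbit_closure_freq_bound[OF \<nu>0(1) U(3)[OF u(1)] this]
    show False using not_close[OF n u(2) mass_bounds[OF \<nu>0(1)]] by blast
  qed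
  \<comment> \<open>Otherwise the averages along \<open>z \<nu>\<close> would give
    \<open>\<nu>\<close> nearly the masses of \<open>\<mu>\<close>.\<close>
  have esc: "\<exists>t\<ge>T. \<not> L \<mu> (window (z \<nu>) t n)"
    if n: "N3 \<le> n" "0 < n" and \<nu>: "\<nu> \<in> M" "\<nu> \<noteq> \<mu>" for n \<nu> T
  proof (rule ccontr)
    assume no: "\<not> ?thesis"
    have \<nu>': "invariant_measure X \<nu>" "generic_point X \<nu> (z \<nu>)" using M_inv z_gen \<nu>(1) by auto
    obtain u where u: "u \<in> U" "3 * e \<le> \<bar>mass \<nu> u - mass \<mu> u\<bar>"
      using U(4)[of "(\<nu>, \<mu>)"] \<nu> by (auto simp: R_def)
    have "\<bar>freq l u (window (z \<nu>) t n) - mass \<mu> u\<bar> \<le> e" if "T \<le> t" for t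
      using no u(1) that by (auto simp: L_def intro: less_imp_le)
    from generic_point_freq_bound[OF \<nu>' U(3)[OF u(1)] this]
    show False using not_close[OF n u(2) mass_bounds[OF \<nu>'(1)]] by blast
  qed
  \<comment> \<open>Every window of a periodic \<open>x\<close> recurs at a start in
    \<open>[0, p)\<close>, where \<open>x\<close> looks like \<open>\<mu>\<close>; this contradicts
    \<open>far\<close>.\<close>
  have nper: "\<not> (\<exists>p>0. \<forall>t. x (t + p) = x t)"
  proof
    assume "\<exists>p>0. \<forall>t. x (t + p) = x t"
    then obtain p where p: "0 < p" "\<And>t. x (t + p) = x t" by blast
    define n where "n = max (nat p) (max 1 (max N2 N3))"
    have n: "p \<le> int n" "N2 \<le> n" "N3 \<le> n" "0 < n" using p(1) by (auto simp: n_def)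
    obtain c where c: "\<not> L \<mu> (window x c n)" using far[OF n(3,4)] by blast
    have x_mult: "x (t + p * int i) = x t" for t i
      using periodic_multiple[of t x p t i] p by simp
    have x_mod: "x (c + t) = x (c mod p + t)" for t
    proof (cases "0 \<le> c div p")
      case True
      have "c + t = (c mod p + t) + p * int (nat (c div p))" using True by (simp add: algebra_simps)
      then show ?thesis using x_mult by metis
    next
      case False
      have "c mod p + t = (c + t) + p * int (nat (- (c div p)))"
        using False by (simp add: algebra_simps minus_mult_div_eq_mod[symmetric])
      then show ?thesis using x_mult by metis
    qed
    then have "window x c n = window x (c mod p) n" by (simp add: window_def)
    moreover have "L \<mu> (window (z \<mu>) (c mod p) n)"
    proof (rule Lz)
      have "c mod p < p" "0 \<le> c mod p" using p(1) by auto
      then have "real_of_int (c mod p) \<le> 1 * real n" using n(1) by linarith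
      also have "1 * real n \<le> K * real n"
        by (rule mult_right_mono) (use \<delta> in \<open>simp_all add: K_def add_increasing\<close>)
      finally show "real_of_int (c mod p) \<le> K * real n" .
    qed (use p(1) n(2) in auto)
    ultimately show False using c by (simp add: z_def)
  qed
  define N where "N = max N1 (max N2 N3)"
  \<comment> \<open>From \<open>S0\<close> on, \<open>\<delta> * S\<close> is at least
    \<open>N\<close>, and so is the length found at scale \<open>S\<close>.\<close>
  define S0 where "S0 = max N (max L0 (nat \<lceil>real N / \<delta>\<rceil>))"
  have S0: "L0 \<le> S0" by (simp add: S0_def)
  have big: "N \<le> n" if "S0 \<le> S" "\<delta> * real S \<le> real n" for S n
  proof -
    have "real N / \<delta> \<le> real (nat \<lceil>real N / \<delta>\<rceil>)" by (rule real_nat_ceiling_ge)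
    also have "\<dots> \<le> real S" using that(1) by (simp add: S0_def)
    finally have "real N \<le> \<delta> * real S" using \<delta> by (simp add: field_simps)
    with that(2) show ?thesis by linarith
  qed
  have "\<exists>n\<ge>N. ?P (Suc n) < ?P n + k \<and> (\<mu> \<in> M \<longrightarrow> (\<exists>s t. 0 \<le> s \<and> 0 \<le> t \<and>
      real_of_int s \<le> (real k + 1) / \<delta> * real n \<and> real_of_int t \<le> (real k + 1) / \<delta> * real n \<and>
      window x s n = window x t n \<and> x (s + int n) \<noteq> x (t + int n)))"
  proof (cases "\<mu> \<in> M")
    case False
    obtain n where n: "\<delta> * real S0 \<le> real n" "?P (Suc n) < ?P n + k"
      using scale[OF S0] by blast
    then show ?thesis using big[OF order_refl n(1)] False by blast
  next
    case True
    have "\<not> eventually_periodic x" using z_nep[OF True] by (simp add: z_def)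
    moreover have "?P S0 \<le> k * S0" by (rule Pk) (simp add: S0_def N_def le_max_iff_disj)
    \<comment> \<open>Branching fixes \<open>S\<close> first and holds for every length up to
      \<open>S\<close>, with no upper bound on \<open>S\<close>. Slow growth then picks
      \<open>n\<close> between \<open>\<delta> * S\<close> and \<open>S\<close>, so that branching
      positions of order \<open>S\<close> are also of order \<open>n\<close>.\<close>
    ultimately obtain S where S: "S0 \<le> S" and br: "\<And>n. n \<le> S \<Longrightarrow>
        \<exists>s t. 0 \<le> s \<and> 0 \<le> t \<and> s \<le> int ((k + 1) * S) \<and> t \<le> int ((k + 1) * S) \<and>
          window x s n = window x t n \<and> x (s + int n) \<noteq> x (t + int n)"
      using branching_scale[OF x _ fin] by metis
    obtain n where n: "\<delta> * real S \<le> real n" "n \<le> S" "?P (Suc n) < ?P n + k"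
      using scale[OF order_trans[OF S0 S]] by blast
    have "real S \<le> real n / \<delta>" using n(1) \<delta> by (simp add: field_simps)
    then have "(real k + 1) * real S \<le> (real k + 1) * (real n / \<delta>)" by (intro mult_left_mono) auto
    then have le: "real_of_int s \<le> (real k + 1) / \<delta> * real n" if "s \<le> int ((k + 1) * S)" for s
    proof -
      have "real_of_int s \<le> (real k + 1) * real S" using that by (simp flip: of_int_le_iff[where 'a = real] add: algebra_simps)
      also have "\<dots> \<le> (real k + 1) * (real n / \<delta>)" by fact
      finally show ?thesis by simp
    qed
    show ?thesis using big[OF S n(1)] n(3) br[OF n(2)] le by blast
  qed
  then obtain n where n: "N \<le> n" "?P (Suc n) < ?P n + k"
    and branch: "\<mu> \<in> M \<Longrightarrow> \<exists>s t. 0 \<le> s \<and> 0 \<le> t \<and>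
      real_of_int s \<le> (real k + 1) / \<delta> * real n \<and> real_of_int t \<le> (real k + 1) / \<delta> * real n \<and>
      window x s n = window x t n \<and> x (s + int n) \<noteq> x (t + int n)"
    by blast
  have n': "N1 \<le> n" "N2 \<le> n" "N3 \<le> n" "0 < n" using n(1) by (auto simp: N_def N1_def)
  define C where "C = \<lfloor>K * real n\<rfloor>"
  have C: "t \<le> C \<longleftrightarrow> real_of_int t \<le> K * real n" for t by (simp add: C_def le_floor_iff)
  have P_le: "real (?P n) \<le> real k * real n" using Pk[OF n'(1)] by (simp flip: of_nat_mult)
  have Kn: "K * real n = (real k + 1) / \<delta> * real n + 2 * (real k * real n) + 3 * real n"
    by (simp add: K_def algebra_simps)
  have q1: "0 \<le> (real k + 1) / \<delta> * real n" using \<delta> by simp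
  have n1: "1 \<le> real n" using n'(4) by simp
  obtain c where c: "\<not> L \<mu> (window x c n)" using far[OF n'(3,4)] by blast
  show False
  proof (rule rauzy_graph_contradiction[where X = X and n = n and M = M and x = x and z = z
        and L = L and C = C and \<mu> = \<mu> and c = c])
    show "?P (Suc n) \<le> ?P n + card M" using n(2) M(2) k by simp
    show "L \<nu> (window (z \<nu>) t n)" if "\<nu> \<in> M" "0 \<le> t" "t \<le> C" for \<nu> t
      using Lz[OF n'(2), of \<nu> t] that C by simp
    show "L \<mu> (window x t n)" if "0 \<le> t" "t \<le> C" for t
      using Lz[OF n'(2), of \<mu> t] that C by (simp add: z_def)
    show "\<exists>t\<ge>T. \<not> L \<mu> (window (z \<nu>) t n)" if "\<nu> \<in> M" "\<nu> \<noteq> \<mu>" for \<nu> T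
      using esc[OF n'(3,4) that] .
    show "2 * int (?P n) + 2 \<le> C" unfolding C using P_le Kn q1 n1 by simp
    show "z \<mu> = x \<and> (\<exists>s t. 0 \<le> s \<and> 0 \<le> t \<and>
        s + int (?P n) + 1 \<le> C \<and> t + int (?P n) + 1 \<le> C \<and>
        window x s n = window x t n \<and> x (s + int n) \<noteq> x (t + int n))" if "\<mu> \<in> M"
    proof -
      have "s + int (?P n) + 1 \<le> C" if "real_of_int s \<le> (real k + 1) / \<delta> * real n" for s
        unfolding C using that P_le Kn n1 by simp
      then show ?thesis using branch[OF that] by (auto simp: z_def)
    qed
    show "z \<nu> \<in> X" if "\<nu> \<in> M" for \<nu> using z_gen that by (auto simp: generic_point_def)
    show "\<nu> = \<nu>'" if "\<nu> \<in> insert \<mu> M" "\<nu>' \<in> insert \<mu> M" "L \<nu> w" "L \<nu>' w" for \<nu> \<nu>' w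
      using excl that .
  qed (use fin M(3) x nper z_nep c n'(4) in auto)
qed

end
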